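(* Let $m,n,l$ be positive integers with $l\le n$. Let $\mathbf{r}=(r_1,\ldots,r_n)$ be an $n$-tuple of non-negative integers with $|\mathbf{r}|=m+l$, and let $\mathbf{r}'=(r'_1,\ldots,r'_n)$ with $r'_i=1$ for $i=1,\ldots,l$ and $r'_j=0$ for $j=l+1,\ldots,n$. Let $S_k=\sum_{i=1}^k r_i$ and $S'_k=\sum_{i=1}^k r'_i$ for $k=0,\ldots,n$. Let $P_{\min}=[m+n+l]\setminus\{S_k+k: k=1,\ldots,n\}$ and $P'_{\max}=[n+l]\setminus\{S'_{k-1}+k: k=1,\ldots,n\}$. Then $$\sum_{P,P'}(-1)^{d'(P')}\operatorname{M}_{\mathbf{x}}\big(T(n+l,m;P,P')\big)=\prod_{i=1}^{m}(1+x_i)\cdot\operatorname{M}_{\mathbf{x}}\big(T(n+l,m;P_{\min},P'_{\max})\big),$$ where the sum runs over all $P\subseteq[m+n+l]$ with $|P\cap([S_k+k]\setminus[S_{k-1}+k-1])|=r_k$ for each $k=1,\ldots,n$, and all $P'\subseteq[n+l]$ with $|P'\cap([S'_k+k]\setminus[S'_{k-1}+k-1])|=r'_k$ for each $k=1,\ldots,n$, and $d'(P')=\sum_{x\in P'_{\max}}x-\sum_{x\in P'}x$. (The left-hand side is the signed enumeration $\operatorname{M}^{\mathbf{r},\mathbf{r}'}_{\mathbf{x},\mathrm{sgn}}(H(m,m,n+l))$ of $(\mathbf{r},\mathbf{r}')$-block diagonally symmetric lozenge tilings of $H(m,m,n+l)$.)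
   Context: $[N]=\{1,\ldots,N\}$, $[0]=\emptyset$. Work on the triangular lattice with unit triangles of side $1$ and one family of lattice lines vertical. Lozenges (unions of two adjacent unit triangles) are horizontal, positive or negative according to whether their long diagonal is horizontal, of positive slope, or of negative slope. For positive integers $N,m$, $T(N,m)$ is the trapezoidal lattice region with sides of lengths $N$ (left, vertical), $m$, $m+N$ (right, vertical), $m$ in clockwise order from the left side. Label the $N$ right-pointing unit triangles along the left side by $1,\ldots,N$ from bottom to top, and the $m+N$ left-pointing unit triangles along the right side by $1,\ldots,m+N$ from bottom to top. For $P\subseteq[m+N]$ and $P'\subseteq[N]$, $T(N,m;P,P')$ is obtained from $T(N,m)$ by deleting the left-pointing triangles on the right side labeled by $P$ and the right-pointing triangles on the left side labeled by $P'$. In a lozenge tiling of such a region, horizontal and positive lozenges have weight $1$, and a negative lozenge whose right vertical side is at distance $\tfrac{\sqrt3}{2}k$ from the right side of $T(N,m)$ has weight $x_{k+1}$; the weight of a tiling is the product of the weights of its lozenges, and $\operatorname{M}_{\mathbf{x}}(R)$ denotes the sum of the weights of all lozenge tilings of the region $R$ (zero if there are none). *)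

theory Defs
  imports Complex_Main "HOL-Library.Disjoint_Sets"
begin

(* The triangular lattice in oblique coordinates: (a, b) is the lattice point at horizontal
   position sqrt 3 / 2 * a and height b + a / 2, so that the lines of constant a are the vertical
   lattice lines and the lines of constant b have positive slope. *)
type_synonym point = "int \<times> int"

definition xpos :: "point \<Rightarrow> real" where
  "xpos p = sqrt 3 / 2 * of_int (fst p)"

definition ypos :: "point \<Rightarrow> real" where
  "ypos p = of_int (snd p) + of_int (fst p) / 2"

(* Unit triangles are represented by their sets of vertices. A right-pointing triangle has a
   vertical side on its left, with lower end (a, b); a left-pointing one has its apex at (a, b)
   and its vertical side on the line a + 1. *)
definition right_tri :: "int \<Rightarrow> int \<Rightarrow> point set" where
  "right_tri a b = {(a, b), (a, b + 1), (a + 1, b)}"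

definition left_tri :: "int \<Rightarrow> int \<Rightarrow> point set" where
  "left_tri a b = {(a, b), (a + 1, b - 1), (a + 1, b)}"

definition unit_triangles :: "point set set" where
  "unit_triangles = {right_tri a b | a b. True} \<union> {left_tri a b | a b. True}"

(* A lozenge is the set of its two unit triangles; they are adjacent if they share a side. *)
definition lozenges :: "point set set set" where
  "lozenges = {{t, u} | t u. t \<in> unit_triangles \<and> u \<in> unit_triangles \<and> card (t \<inter> u) = 2}"

(* The ends of the long diagonal are the two vertices that are not shared by both triangles. *)
definition long_diagonal :: "point set set \<Rightarrow> point set" where
  "long_diagonal L = \<Union>L - \<Inter>L"

definition negative_lozenge :: "point set set \<Rightarrow> bool" where
  "negative_lozenge L \<longleftrightarrow>
     L \<in> lozenges \<and> (\<exists>p q. long_diagonal L = {p, q} \<and> xpos p < xpos q \<and> ypos q < ypos p)"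

(* T(N, m) is placed with the lower left corner at (0, 0). Its left side lies on a = 0, its right
   side on a = m; the lower side, of slope -1 / sqrt 3, is b = -a, and the upper side is b = N. *)
definition trapezoid_points :: "nat \<Rightarrow> nat \<Rightarrow> point set" where
  "trapezoid_points N m = {(a, b). 0 \<le> a \<and> a \<le> int m \<and> - a \<le> b \<and> b \<le> int N}"

(* Lattice regions are represented by the sets of unit triangles they consist of. *)
definition trapezoid :: "nat \<Rightarrow> nat \<Rightarrow> point set set" where
  "trapezoid N m = {t \<in> unit_triangles. t \<subseteq> trapezoid_points N m}"

(* Labels count from 1, from bottom to top. *)
definition left_side_tri :: "nat \<Rightarrow> point set" where
  "left_side_tri i = right_tri 0 (int i - 1)"

definition right_side_tri :: "nat \<Rightarrow> nat \<Rightarrow> point set" where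
  "right_side_tri m i = left_tri (int m - 1) (int i - int m)"

definition dented_trapezoid :: "nat \<Rightarrow> nat \<Rightarrow> nat set \<Rightarrow> nat set \<Rightarrow> point set set" where
  "dented_trapezoid N m P P' = trapezoid N m - right_side_tri m ` P - left_side_tri ` P'"

definition tilings :: "point set set \<Rightarrow> point set set set set" where
  "tilings R = {\<T>. \<T> \<subseteq> lozenges \<and> partition_on R \<T>}"

(* The right vertical side of a negative lozenge lies on the line a = Max (fst ` \<Union>L), which
   is k = m - a lattice lines away from the right side a = m of T(N, m). *)
definition lozenge_weight :: "nat \<Rightarrow> (nat \<Rightarrow> 'a::comm_ring_1) \<Rightarrow> point set set \<Rightarrow> 'a" where
  "lozenge_weight m x L =
     (if negative_lozenge L then x (nat (int m - Max (fst ` \<Union>L)) + 1) else 1)"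

definition tiling_sum :: "nat \<Rightarrow> (nat \<Rightarrow> 'a::comm_ring_1) \<Rightarrow> point set set \<Rightarrow> 'a" where
  "tiling_sum m x R = (\<Sum>\<T>\<in>tilings R. \<Prod>L\<in>\<T>. lozenge_weight m x L)"

(* Tuples (r_1, ..., r_n) are functions on nat of which only the values at 1, ..., n matter. *)
definition psum :: "(nat \<Rightarrow> nat) \<Rightarrow> nat \<Rightarrow> nat" where
  "psum r k = (\<Sum>i=1..k. r i)"

definition block_sets :: "nat \<Rightarrow> nat \<Rightarrow> (nat \<Rightarrow> nat) \<Rightarrow> nat set set" where
  "block_sets K n r = {P. P \<subseteq> {1..K} \<and>
     (\<forall>k\<in>{1..n}. card (P \<inter> ({1..psum r k + k} - {1..psum r (k - 1) + k - 1})) = r k)}"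

definition block_min :: "nat \<Rightarrow> nat \<Rightarrow> (nat \<Rightarrow> nat) \<Rightarrow> nat set" where
  "block_min K n r = {1..K} - {psum r k + k | k. k \<in> {1..n}}"

definition block_max :: "nat \<Rightarrow> nat \<Rightarrow> (nat \<Rightarrow> nat) \<Rightarrow> nat set" where
  "block_max K n r = {1..K} - {psum r (k - 1) + k | k. k \<in> {1..n}}"

definition label_defect :: "nat set \<Rightarrow> nat set \<Rightarrow> int" where
  "label_defect Q P = int (\<Sum>Q) - int (\<Sum>P)"

lemma finite_trapezoid: "finite (trapezoid N m)"
proof -
  have "trapezoid_points N m \<subseteq> {0..int m} \<times> {- int m..int N}"
    by (auto simp: trapezoid_points_def)
  then have "finite (trapezoid_points N m)"
    by (rule finite_subset) simp
  moreover have "trapezoid N m \<subseteq> Pow (trapezoid_points N m)"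
    by (auto simp: trapezoid_def)
  ultimately show ?thesis
    using finite_subset by blast
qed

lemma finite_tilings:
  assumes "finite R"
  shows "finite (tilings R)"
proof (rule finite_subset)
  show "tilings R \<subseteq> Pow (Pow R)"
    by (auto simp: tilings_def partition_on_def)
qed (use assms in simp)

lemma finite_block_sets: "finite (block_sets K n r)"
  by (rule finite_subset[of _ "Pow {1..K}"]) (auto simp: block_sets_def)

end

theory Submission
  imports Defs "Jordan_Normal_Form.Determinant"
begin

text \<open>Reading a tiling column by column from the left, the vertical lattice segments not crossed by
  horizontal lozenges form \<open>n\<close> particles; in each column a particle keeps its label (negative
  lozenge) or raises it by one (positive lozenge), and no two particles meet. Removing the
  rightmost column shows that the tiling sum with particles starting at \<open>b\<^sub>1 < \<dots> < b\<^sub>n\<close> and ending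
  at \<open>c\<^sub>1 < \<dots> < c\<^sub>n\<close> satisfies the same recursion as \<open>det (h (c\<^sub>i - b\<^sub>j))\<close>, where \<open>h k\<close> is the elementary
  symmetric polynomial of degree \<open>m - k\<close> in \<open>x\<^sub>1, \<dots>, x\<^sub>m\<close>: illegal moves give determinants with two
  equal rows or a zero row.

  Block sets are the complements of the choices of one label per block, so multilinearity turns
  the signed sum into one determinant. Summing its rows cumulatively, the signs make the columns of
  the blocks of size two telescope to \<open>h (v\<^sub>i - b\<^sub>j)\<close>, where \<open>v\<^sub>i\<close> is the top of the \<open>i\<close>-th block;
  the other columns hold partial sums of \<open>h\<close>, and column operations reduce all but the last of
  them to \<open>h (v\<^sub>i - b\<^sub>j)\<close> as well. The last row now vanishes off the diagonal (entirely, if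
  \<open>l = n\<close>), and its last entry is \<open>h 0 + \<dots> + h m\<close>, the product of the factors \<open>1 + x\<^sub>i\<close>, where the
  minimal-maximal region has \<open>h m = 1\<close>.\<close>

section \<open>Multilinearity of determinants\<close>

text \<open>The entries come from a function on all of \<open>nat\<close>: they can be rewritten
  under binders without carrier conditions, and one array yields determinants of several
  sizes.\<close>

definition fdet :: "nat \<Rightarrow> (nat \<Rightarrow> nat \<Rightarrow> 'a::comm_ring_1) \<Rightarrow> 'a" where
  "fdet n f = det (mat n n (\<lambda>(i, j). f i j))"

lemma fdet_leibniz:
  "fdet n f = (\<Sum>p | p permutes {..<n}. signof p * (\<Prod>i<n. f i (p i)))"
  unfolding fdet_def
  by (subst det_def'[of _ n])
     (auto simp: atLeast0LessThan intro!: sum.cong prod.cong dest: permutes_in_image)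

lemma fdet_cong:
  assumes "\<And>i j. i < n \<Longrightarrow> j < n \<Longrightarrow> f i j = g i j"
  shows "fdet n f = fdet n g"
  unfolding fdet_def using assms by (intro arg_cong[where f = det] eq_matI) auto

lemma fdet_transpose: "fdet n (\<lambda>i j. f j i) = fdet n f"
proof -
  have "transpose_mat (mat n n (\<lambda>(i, j). f i j)) = mat n n (\<lambda>(i, j). f j i)"
    by (intro eq_matI) auto
  then show ?thesis
    unfolding fdet_def by (metis det_transpose mat_carrier)
qed

text \<open>Multiplying out the product of row sums in each Leibniz term leaves one summand for
  every choice of an index per row.\<close>

lemma fdet_sum_rows:
  assumes "\<And>i. i < n \<Longrightarrow> finite (S i)"
  shows "fdet n (\<lambda>i j. \<Sum>k\<in>S i. g i k j) = (\<Sum>\<kappa>\<in>PiE {..<n} S. fdet n (\<lambda>i j. g i (\<kappa> i) j))"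
proof -
  have "fdet n (\<lambda>i j. \<Sum>k\<in>S i. g i k j)
      = (\<Sum>p | p permutes {..<n}. \<Sum>\<kappa>\<in>PiE {..<n} S. signof p * (\<Prod>i<n. g i (\<kappa> i) (p i)))"
    unfolding fdet_leibniz
    by (intro sum.cong refl, subst prod_sum_PiE) (auto simp: sum_distrib_left assms)
  then show ?thesis
    unfolding fdet_leibniz by (subst (asm) sum.swap)
qed

lemma fdet_sum_cols:
  assumes "\<And>j. j < n \<Longrightarrow> finite (S j)"
  shows "fdet n (\<lambda>i j. \<Sum>k\<in>S j. g i j k) = (\<Sum>\<kappa>\<in>PiE {..<n} S. fdet n (\<lambda>i j. g i j (\<kappa> j)))"
proof -
  have "fdet n (\<lambda>i j. \<Sum>k\<in>S i. g j i k) = (\<Sum>\<kappa>\<in>PiE {..<n} S. fdet n (\<lambda>i j. g j i (\<kappa> i)))"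
    using assms by (rule fdet_sum_rows)
  then show ?thesis
    using fdet_transpose[of n "\<lambda>i j. \<Sum>k\<in>S j. g i j k"]
      fdet_transpose[of n "\<lambda>i j. g i j (\<kappa> j)" for \<kappa>] by simp
qed

lemma fdet_scale_rows: "fdet n (\<lambda>i j. a i * f i j) = (\<Prod>i<n. a i) * fdet n f"
  unfolding fdet_leibniz by (simp add: prod.distrib sum_distrib_left mult_ac)

lemma fdet_scale_cols: "fdet n (\<lambda>i j. a j * f i j) = (\<Prod>j<n. a j) * fdet n f"
  using fdet_scale_rows[of n a "\<lambda>j i. f i j"] fdet_transpose[of n f]
    fdet_transpose[of n "\<lambda>i j. a j * f i j"] by simp

lemma fdet_zero_row:
  assumes "i < n" "\<And>j. j < n \<Longrightarrow> f i j = 0"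
  shows "fdet n f = 0"
  unfolding fdet_leibniz
proof (intro sum.neutral ballI)
  fix p assume "p \<in> {p. p permutes {..<n}}"
  then have "p i < n" using assms(1) permutes_in_image by fastforce
  then have "(\<Prod>i<n. f i (p i)) = 0"
    using assms by (intro prod_zero) auto
  then show "signof p * (\<Prod>i<n. f i (p i)) = 0" by simp
qed

lemma fdet_equal_rows:
  assumes "i < n" "i' < n" "i \<noteq> i'" "\<And>j. j < n \<Longrightarrow> f i j = f i' j"
  shows "fdet n f = 0"
  unfolding fdet_def using assms by (intro det_identical_rows[of _ n i i'] eq_vecI) auto

text \<open>Laplace expansion along the last row, where only the diagonal entry survives.\<close>

lemma fdet_Suc_last_row:
  assumes "\<And>j. j < n \<Longrightarrow> f n j = 0"
  shows "fdet (Suc n) f = f n n * fdet n f"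
proof -
  let ?A = "mat (Suc n) (Suc n) (\<lambda>(i, j). f i j)"
  have "mat_delete ?A n n = mat n n (\<lambda>(i, j). f i j)"
    by (intro eq_matI) (auto simp: mat_delete_def)
  then have "cofactor ?A n n = fdet n f"
    by (simp add: cofactor_def fdet_def)
  moreover have "det ?A = (\<Sum>j<Suc n. ?A $$ (n, j) * cofactor ?A n j)"
    by (rule laplace_expansion_row) auto
  ultimately show ?thesis
    using assms by (simp add: fdet_def)
qed

text \<open>Left multiplication by a lower unitriangular matrix, of determinant 1: row
  \<open>i\<close> receives multiples of earlier rows.\<close>

lemma fdet_unitriangular_rows:
  assumes T: "\<And>i. i < n \<Longrightarrow> T i i = 1" "\<And>i k. i < k \<Longrightarrow> k < n \<Longrightarrow> T i k = 0"
  shows "fdet n (\<lambda>i j. \<Sum>k<n. T i k * f k j) = fdet n f"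
proof -
  let ?T = "mat n n (\<lambda>(i, j). T i j)" and ?F = "mat n n (\<lambda>(i, j). f i j)"
  have "det ?T = 1"
    by (subst det_lower_triangular[of n]) (auto simp: T prod_list_diag_prod)
  moreover have "mat n n (\<lambda>(i, j). \<Sum>k<n. T i k * f k j) = ?T * ?F"
    by (intro eq_matI) (auto simp: scalar_prod_def atLeast0LessThan)
  ultimately show ?thesis
    unfolding fdet_def by (simp add: det_mult[of _ n])
qed

text \<open>The lower unitriangular matrix now acts from the right, so column \<open>j\<close>
  receives multiples of later columns.\<close>

lemma fdet_unitriangular_cols:
  assumes T: "\<And>j. j < n \<Longrightarrow> T j j = 1" "\<And>k j. k < j \<Longrightarrow> j < n \<Longrightarrow> T k j = 0"
  shows "fdet n (\<lambda>i j. \<Sum>k<n. f i k * T k j) = fdet n f"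
proof -
  let ?T = "mat n n (\<lambda>(i, j). T i j)" and ?F = "mat n n (\<lambda>(i, j). f i j)"
  have "det ?T = 1"
    by (subst det_lower_triangular[of n]) (auto simp: T prod_list_diag_prod)
  moreover have "mat n n (\<lambda>(i, j). \<Sum>k<n. f i k * T k j) = ?F * ?T"
    by (intro eq_matI) (auto simp: scalar_prod_def atLeast0LessThan)
  ultimately show ?thesis
    unfolding fdet_def by (simp add: det_mult[of _ n])
qed

section \<open>Lozenges on the triangular lattice\<close>

lemma right_tri_eq_iff [simp]: "right_tri a b = right_tri c d \<longleftrightarrow> a = c \<and> b = d"
proof
  assume eq: "right_tri a b = right_tri c d"
  have "Min (fst ` right_tri e f) = e" "(e, f) \<in> right_tri e f"
    "\<And>y. (e, y) \<in> right_tri e f \<Longrightarrow> f \<le> y" for e f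
    by (auto simp: right_tri_def)
  with eq show "a = c \<and> b = d"
    by (metis order.antisym)
qed simp

lemma left_tri_eq_iff [simp]: "left_tri a b = left_tri c d \<longleftrightarrow> a = c \<and> b = d"
proof
  assume eq: "left_tri a b = left_tri c d"
  have "Min (fst ` left_tri e f) = e" "(e, f) \<in> left_tri e f"
    "\<And>y. (e, y) \<in> left_tri e f \<Longrightarrow> f = y" for e f
    by (auto simp: left_tri_def)
  with eq show "a = c \<and> b = d"
    by metis
qed simp

lemma right_tri_neq_left_tri [simp]: "right_tri a b \<noteq> left_tri c d" "left_tri c d \<noteq> right_tri a b"
proof -
  have "(c + 1, d) \<in> left_tri c d" "(c + 1, d - 1) \<in> left_tri c d" "(c, d) \<in> left_tri c d"
    by (auto simp: left_tri_def)
  \<comment> \<open>Two points on the vertical line \<open>c + 1\<close> force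
    \<open>c + 1 = a\<close>, and then \<open>(c, d)\<close> lies to the left of the right-pointing
    triangle.\<close>
  moreover have "\<not> ((c + 1, d) \<in> right_tri a b \<and> (c + 1, d - 1) \<in> right_tri a b \<and> (c, d) \<in> right_tri a b)"
    unfolding right_tri_def by (simp, presburger)
  ultimately show "right_tri a b \<noteq> left_tri c d" by metis
  then show "left_tri c d \<noteq> right_tri a b" by simp
qed

text \<open>The alternatives are the lower, the upper and the vertical side of the right-pointing
  triangle; they lead to negative, positive and horizontal lozenges.\<close>

lemma right_tri_Int_left_tri:
  "card (right_tri a b \<inter> left_tri c d) = 2 \<longleftrightarrow>
     c = a \<and> d = b \<or> c = a \<and> d = b + 1 \<or> c = a - 1 \<and> d = b + 1"
proof -
  \<comment> \<open>Splitting the intersection into singletons turns its cardinality into a sum of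
    three indicators, which arithmetic decides.\<close>
  have "right_tri a b \<inter> left_tri c d = (\<Union>p\<in>right_tri a b. if p \<in> left_tri c d then {p} else {})"
    by auto
  also have "card \<dots> = (\<Sum>p\<in>right_tri a b. if p \<in> left_tri c d then 1 else 0)"
    by (subst card_UN_disjoint) (auto simp: right_tri_def intro!: sum.cong)
  also have "\<dots> = (if (a, b) \<in> left_tri c d then 1 else 0) + (if (a, b + 1) \<in> left_tri c d then 1 else 0)
      + (if (a + 1, b) \<in> left_tri c d then 1 else (0::nat))"
    by (simp add: right_tri_def)
  also have "\<dots> = 2 \<longleftrightarrow> c = a \<and> d = b \<or> c = a \<and> d = b + 1 \<or> c = a - 1 \<and> d = b + 1"
    by (auto simp: left_tri_def)
  finally show ?thesis .
qed

lemma right_tri_Int_right_tri: "card (right_tri a b \<inter> right_tri c d) \<noteq> 2"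
proof (cases "a = c \<and> b = d")
  case True
  then show ?thesis by (simp add: right_tri_def)
next
  case False
  have "p = q" if "p \<in> right_tri a b \<inter> right_tri c d" "q \<in> right_tri a b \<inter> right_tri c d" for p q
    using that False by (cases p; cases q) (simp add: right_tri_def, smt (z3))
  then show ?thesis by (metis card_2_iff')
qed

lemma left_tri_Int_left_tri: "card (left_tri a b \<inter> left_tri c d) \<noteq> 2"
proof (cases "a = c \<and> b = d")
  case True
  then show ?thesis by (simp add: left_tri_def)
next
  case False
  have "p = q" if "p \<in> left_tri a b \<inter> left_tri c d" "q \<in> left_tri a b \<inter> left_tri c d" for p q
    using that False by (cases p; cases q) (simp add: left_tri_def, smt (z3))
  then show ?thesis by (metis card_2_iff')
qed

lemma lozenge_cases:
  assumes "L \<in> lozenges"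
  obtains (negative) a b where "L = {right_tri a b, left_tri a b}"
  | (positive) a b where "L = {right_tri a b, left_tri a (b + 1)}"
  | (horizontal) a b where "L = {left_tri a b, right_tri (a + 1) (b - 1)}"
proof -
  from assms obtain t u where L: "L = {t, u}" "t \<in> unit_triangles" "u \<in> unit_triangles" "card (t \<inter> u) = 2"
    by (auto simp: lozenges_def)
  from L(2,3) consider a b c d where "t = right_tri a b" "u = right_tri c d"
    | a b c d where "t = right_tri a b" "u = left_tri c d"
    | a b c d where "t = left_tri c d" "u = right_tri a b"
    | a b c d where "t = left_tri a b" "u = left_tri c d"
    unfolding unit_triangles_def by blast
  then have "\<exists>a b c d. L = {right_tri a b, left_tri c d} \<and> card (right_tri a b \<inter> left_tri c d) = 2"
  proof cases
    case 3
    with L(1,4) show ?thesis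
      by (intro exI[of _ a] exI[of _ b] exI[of _ c] exI[of _ d]) (simp add: Int_commute insert_commute)
  qed (use L right_tri_Int_right_tri left_tri_Int_left_tri in blast)+
  then obtain a b c d where *: "L = {right_tri a b, left_tri c d}"
    and "c = a \<and> d = b \<or> c = a \<and> d = b + 1 \<or> c = a - 1 \<and> d = b + 1"
    unfolding right_tri_Int_left_tri by blast
  then consider "c = a" "d = b" | "c = a" "d = b + 1" | "a = c + 1" "b = d - 1" by force
  then show thesis using * that by cases (auto simp: insert_commute)
qed

lemma lozengeI:
  "{right_tri a b, left_tri a b} \<in> lozenges"
  "{right_tri a b, left_tri a (b + 1)} \<in> lozenges"
  "{left_tri a b, right_tri (a + 1) (b - 1)} \<in> lozenges"
proof -
  have *: "right_tri a b \<in> unit_triangles" "left_tri a b \<in> unit_triangles" for a b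
    by (auto simp: unit_triangles_def)
  have **: "card (right_tri a b \<inter> left_tri a b) = 2"
    "card (right_tri a b \<inter> left_tri a (b + 1)) = 2"
    "card (left_tri a b \<inter> right_tri (a + 1) (b - 1)) = 2"
    by (simp_all add: right_tri_Int_left_tri Int_commute[of "left_tri _ _" "right_tri _ _"])
  have "{t, u} \<in> lozenges" if "t \<in> unit_triangles" "u \<in> unit_triangles" "card (t \<inter> u) = 2" for t u
    unfolding lozenges_def using that by (intro CollectI exI[of _ t] exI[of _ u] conjI refl)
  from this[OF *(1) *(2) **(1)] this[OF *(1) *(2) **(2)] this[OF *(2) *(1) **(3)]
  show "{right_tri a b, left_tri a b} \<in> lozenges"
    "{right_tri a b, left_tri a (b + 1)} \<in> lozenges"
    "{left_tri a b, right_tri (a + 1) (b - 1)} \<in> lozenges"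
    by simp_all
qed

lemma negative_lozenge_same_label: "negative_lozenge {right_tri a b, left_tri a b}"
proof -
  have "long_diagonal {right_tri a b, left_tri a b} = {(a, b + 1), (a + 1, b - 1)}"
    by (auto simp: long_diagonal_def right_tri_def left_tri_def)
  then show ?thesis
    unfolding negative_lozenge_def using lozengeI(1)
    by (intro conjI exI[of _ "(a, b + 1)"] exI[of _ "(a + 1, b - 1)"])
       (auto simp: xpos_def ypos_def field_simps)
qed

text \<open>The diagonal is an unordered pair, so its ends can be named in two ways: one has the
  wrong order of heights, the other runs from right to left. Equal heights are allowed for the sake
  of horizontal lozenges.\<close>

lemma not_negative_lozenge:
  assumes "long_diagonal L = {p, q}" "xpos p < xpos q" "ypos p \<le> ypos q"
  shows "\<not> negative_lozenge L"
proof
  assume "negative_lozenge L"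
  then have "\<exists>p' q'. long_diagonal L = {p', q'} \<and> xpos p' < xpos q' \<and> ypos q' < ypos p'"
    unfolding negative_lozenge_def by (rule conjunct2)
  then obtain p' q' where *: "long_diagonal L = {p', q'}" "xpos p' < xpos q'" "ypos q' < ypos p'"
    by (elim exE conjE)
  then have "p = p' \<and> q = q' \<or> p = q' \<and> q = p'"
    using assms(1) by (simp add: doubleton_eq_iff)
  with *(2,3) assms(2,3) show False
    by (elim disjE conjE) simp_all
qed

lemma not_negative_positive: "\<not> negative_lozenge {right_tri a b, left_tri a (b + 1)}"
proof (rule not_negative_lozenge)
  show "long_diagonal {right_tri a b, left_tri a (b + 1)} = {(a, b), (a + 1, b + 1)}"
    by (auto simp: long_diagonal_def right_tri_def left_tri_def)
qed (auto simp: xpos_def ypos_def field_simps)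

lemma not_negative_horizontal: "\<not> negative_lozenge {left_tri a b, right_tri (a + 1) (b - 1)}"
proof (rule not_negative_lozenge)
  show "long_diagonal {left_tri a b, right_tri (a + 1) (b - 1)} = {(a, b), (a + 2, b - 1)}"
    by (auto simp: long_diagonal_def right_tri_def left_tri_def)
qed (auto simp: xpos_def ypos_def field_simps)

lemma lozenge_weight_same_label:
  "lozenge_weight m x {right_tri a b, left_tri a b} = x (nat (int m - a - 1) + 1)"
proof -
  have "fst ` \<Union>{right_tri a b, left_tri a b} = {a, a + 1}"
    by (auto simp: right_tri_def left_tri_def)
  then show ?thesis
    by (simp add: lozenge_weight_def negative_lozenge_same_label algebra_simps)
qed

text \<open>Triangles are indexed by their column, counted from 0 at the left side, and their label
  within the column, counted from 1 at the bottom.\<close>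

definition rtri :: "nat \<Rightarrow> nat \<Rightarrow> point set" where
  "rtri a j = right_tri (int a) (int j - int a - 1)"

definition ltri :: "nat \<Rightarrow> nat \<Rightarrow> point set" where
  "ltri a j = left_tri (int a) (int j - int a - 1)"

lemma rtri_eq_iff [simp]: "rtri a j = rtri b k \<longleftrightarrow> a = b \<and> j = k"
  by (auto simp: rtri_def)

lemma ltri_eq_iff [simp]: "ltri a j = ltri b k \<longleftrightarrow> a = b \<and> j = k"
  by (auto simp: ltri_def)

lemma rtri_neq_ltri [simp]: "rtri a j \<noteq> ltri b k" "ltri b k \<noteq> rtri a j"
  by (auto simp: rtri_def ltri_def)

text \<open>The label \<open>b + a + 1\<close> is 1 along the slanted lower side
  \<open>b = - a\<close>. Each column has one left-pointing triangle more than right-pointing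
  ones.\<close>

lemma trapezoid_conv_tri:
  "trapezoid N m = {rtri a j | a j. a < m \<and> j \<in> {1..N + a}} \<union> {ltri a j | a j. a < m \<and> j \<in> {1..N + a + 1}}"
  (is "_ = ?R \<union> ?L")
proof (intro Set.set_eqI iffI)
  fix t assume "t \<in> trapezoid N m"
  then have t: "t \<in> unit_triangles" "t \<subseteq> trapezoid_points N m" by (auto simp: trapezoid_def)
  from t(1) consider a b where "t = right_tri a b" | a b where "t = left_tri a b"
    by (auto simp: unit_triangles_def)
  then show "t \<in> ?R \<union> ?L"
  proof cases
    case 1
    with t(2) have "t = rtri (nat a) (nat (b + a + 1)) \<and> nat a < m \<and> nat (b + a + 1) \<in> {1..N + nat a}"
      by (auto simp: rtri_def right_tri_def[of a b] trapezoid_points_def)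
    then show ?thesis by blast
  next
    case 2
    with t(2) have "t = ltri (nat a) (nat (b + a + 1)) \<and> nat a < m \<and> nat (b + a + 1) \<in> {1..N + nat a + 1}"
      by (auto simp: ltri_def left_tri_def[of a b] trapezoid_points_def)
    then show ?thesis by blast
  qed
next
  fix t assume "t \<in> ?R \<union> ?L"
  then show "t \<in> trapezoid N m"
    by (auto simp: trapezoid_def unit_triangles_def rtri_def ltri_def)
       (auto simp: right_tri_def left_tri_def trapezoid_points_def)
qed

lemma left_side_tri_conv: "left_side_tri i = rtri 0 i"
  by (simp add: left_side_tri_def rtri_def)

lemma right_side_tri_conv: "right_side_tri (Suc m) i = ltri m i"
  by (simp add: right_side_tri_def ltri_def)

section \<open>Decomposing tilings\<close>

lemma lozenge_nonempty: "L \<in> lozenges \<Longrightarrow> L \<noteq> {}"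
  by (auto simp: lozenges_def)

lemma tilings_iff: "\<T> \<in> tilings R \<longleftrightarrow> \<T> \<subseteq> lozenges \<and> \<Union>\<T> = R \<and> disjoint \<T>"
  using lozenge_nonempty by (auto simp: tilings_def partition_on_def)

lemma tilings_cover:
  assumes "\<T> \<in> tilings R" "t \<in> R"
  shows "\<exists>L\<in>\<T>. t \<in> L \<and> L \<subseteq> R"
  using assms unfolding tilings_iff by blast

lemma tilings_unique:
  assumes "\<T> \<in> tilings R" "L \<in> \<T>" "M \<in> \<T>" "t \<in> L" "t \<in> M"
  shows "L = M"
  using assms unfolding tilings_iff by (meson disjointD disjoint_iff)

text \<open>For disjoint \<open>A\<close> and \<open>B\<close>, these are the candidates for the set
  of lozenges of a tiling that meet both regions. A candidate that extends to no tiling contributes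
  an empty sum later.\<close>

definition crossings :: "point set set \<Rightarrow> point set set \<Rightarrow> point set set set set" where
  "crossings A B = {H. H \<subseteq> lozenges \<and> disjoint H \<and> (\<forall>L\<in>H. L \<subseteq> A \<union> B \<and> \<not> L \<subseteq> A \<and> \<not> L \<subseteq> B)}"

text \<open>A tiling splits into the lozenges meeting both regions, those inside \<open>A\<close>
  and those inside \<open>B\<close>. Once the first set is fixed, the rest of \<open>A\<close> and
  the rest of \<open>B\<close> are tiled independently.\<close>

lemma sum_tilings_Un:
  fixes w :: "point set set \<Rightarrow> 'a::comm_semiring_1"
  assumes "finite A" "finite B" and AB: "A \<inter> B = {}"
  shows "(\<Sum>\<T>\<in>tilings (A \<union> B). prod w \<T>) =
    (\<Sum>H\<in>crossings A B. prod w H * (\<Sum>\<T>\<in>tilings (A - \<Union>H). prod w \<T>) * (\<Sum>\<T>\<in>tilings (B - \<Union>H). prod w \<T>))"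
proof -
  let ?S = "SIGMA H:crossings A B. tilings (A - \<Union>H) \<times> tilings (B - \<Union>H)"
  have fin: "finite (crossings A B)"
    by (rule finite_subset[of _ "Pow (Pow (A \<union> B))"]) (use assms in \<open>auto simp: crossings_def\<close>)
  have dH: "\<not> L \<subseteq> A \<and> \<not> L \<subseteq> B" if "H \<in> crossings A B" "L \<in> H" for H L
    using that by (auto simp: crossings_def)
  have d1: "L \<subseteq> A \<and> \<not> L \<subseteq> B" if "\<T>1 \<in> tilings (A - \<Union>H)" "L \<in> \<T>1" for H \<T>1 L
  proof -
    have "L \<subseteq> A - \<Union>H" "L \<in> lozenges" using that unfolding tilings_iff by blast+
    with lozenge_nonempty[of L] AB show ?thesis by blast
  qed
  have d2: "\<not> L \<subseteq> A \<and> L \<subseteq> B" if "\<T>2 \<in> tilings (B - \<Union>H)" "L \<in> \<T>2" for H \<T>2 L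
  proof -
    have "L \<subseteq> B - \<Union>H" "L \<in> lozenges" using that unfolding tilings_iff by blast+
    with lozenge_nonempty[of L] AB show ?thesis by blast
  qed
  have "(\<Sum>\<T>\<in>tilings (A \<union> B). prod w \<T>) = (\<Sum>(H, \<T>1, \<T>2)\<in>?S. prod w H * prod w \<T>1 * prod w \<T>2)"
  proof (rule sum.reindex_bij_witness[where
        i = "\<lambda>(H, \<T>1, \<T>2). H \<union> \<T>1 \<union> \<T>2" and
        j = "\<lambda>\<T>. ({L \<in> \<T>. \<not> L \<subseteq> A \<and> \<not> L \<subseteq> B}, {L \<in> \<T>. L \<subseteq> A}, {L \<in> \<T>. L \<subseteq> B})"])
    fix \<T> assume \<T>: "\<T> \<in> tilings (A \<union> B)"
    let ?H = "{L \<in> \<T>. \<not> L \<subseteq> A \<and> \<not> L \<subseteq> B}" and ?A = "{L \<in> \<T>. L \<subseteq> A}" and ?B = "{L \<in> \<T>. L \<subseteq> B}"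
    have sub: "\<T> \<subseteq> lozenges" "disjoint \<T>"
      using \<T> by (simp_all add: tilings_iff)
    have sub_AB: "L \<subseteq> A \<union> B" if "L \<in> \<T>" for L
      using \<T> that unfolding tilings_iff by (metis Union_upper)
    have disj_sub: "disjoint {L \<in> \<T>. P L}" for P
      using sub(2) by (rule pairwise_subset) auto
    have H: "?H \<in> crossings A B"
      unfolding crossings_def using sub sub_AB disj_sub by auto
    have nb: "\<not> (L \<subseteq> A \<and> L \<subseteq> B)" if "L \<in> \<T>" for L
    proof -
      from that sub(1) have "L \<noteq> {}" using lozenge_nonempty by blast
      with AB show ?thesis by blast
    qed
    note ex = tilings_cover[OF \<T>] and uniq = tilings_unique[OF \<T>]
    have not_both: "\<not> L \<subseteq> B" if "t \<in> L" "t \<in> A" for t L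
      using that AB by blast
    have not_both': "\<not> L \<subseteq> A" if "t \<in> L" "t \<in> B" for t L
      using that AB by blast
    \<comment> \<open>Every triangle lies in exactly one lozenge, so a triangle of \<open>A\<close>
      outside the crossing lozenges is covered by a lozenge inside \<open>A\<close>.\<close>
    have "\<Union>?A = A - \<Union>?H"
    proof (intro Set.set_eqI iffI)
      fix t assume "t \<in> \<Union>?A"
      then obtain L where L: "L \<in> \<T>" "L \<subseteq> A" "t \<in> L" by auto
      then have "t \<notin> \<Union>?H" using uniq[OF L(1) _ L(3)] L(2) by (metis (no_types, lifting) UnionE mem_Collect_eq)
      with L show "t \<in> A - \<Union>?H" by blast
    next
      fix t assume t: "t \<in> A - \<Union>?H"
      then obtain L where L: "L \<in> \<T>" "t \<in> L" using ex[of t] by blast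
      then have "L \<subseteq> A" using t not_both[of t L] by blast
      with L show "t \<in> \<Union>?A" by blast
    qed
    moreover have "\<Union>?B = B - \<Union>?H"
    proof (intro Set.set_eqI iffI)
      fix t assume "t \<in> \<Union>?B"
      then obtain L where L: "L \<in> \<T>" "L \<subseteq> B" "t \<in> L" by auto
      then have "t \<notin> \<Union>?H" using uniq[OF L(1) _ L(3)] L(2) by (metis (no_types, lifting) UnionE mem_Collect_eq)
      with L show "t \<in> B - \<Union>?H" by blast
    next
      fix t assume t: "t \<in> B - \<Union>?H"
      then obtain L where L: "L \<in> \<T>" "t \<in> L" using ex[of t] by blast
      then have "L \<subseteq> B" using t not_both'[of t L] by blast
      with L show "t \<in> \<Union>?B" by blast
    qed
    ultimately have "?A \<in> tilings (A - \<Union>?H)" "?B \<in> tilings (B - \<Union>?H)"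
      unfolding tilings_iff using sub(1) disj_sub by auto
    then show "(?H, ?A, ?B) \<in> ?S" using H by blast
    show "(case (?H, ?A, ?B) of (H, \<T>1, \<T>2) \<Rightarrow> H \<union> \<T>1 \<union> \<T>2) = \<T>" by blast
    have "finite \<T>" using \<T> assms by (auto simp: tilings_iff intro: finite_UnionD)
    moreover have "\<T> = ?H \<union> ?A \<union> ?B" "?H \<inter> ?A = {}" "(?H \<union> ?A) \<inter> ?B = {}"
      using nb by auto
    ultimately have "prod w \<T> = prod w ?H * prod w ?A * prod w ?B"
      by (metis (no_types, lifting) finite_Un prod.union_disjoint)
    then show "(case (?H, ?A, ?B) of (H, \<T>1, \<T>2) \<Rightarrow> prod w H * prod w \<T>1 * prod w \<T>2) = prod w \<T>"
      by simp
  next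
    fix p assume "p \<in> ?S"
    then obtain H \<T>1 \<T>2 where p: "p = (H, \<T>1, \<T>2)" and H: "H \<in> crossings A B"
      and T: "\<T>1 \<in> tilings (A - \<Union>H)" "\<T>2 \<in> tilings (B - \<Union>H)" by blast
    note d = dH[OF H] d1[OF T(1)] d2[OF T(2)]
    have "{L \<in> H \<union> \<T>1 \<union> \<T>2. \<not> L \<subseteq> A \<and> \<not> L \<subseteq> B} = H"
      "{L \<in> H \<union> \<T>1 \<union> \<T>2. L \<subseteq> A} = \<T>1" "{L \<in> H \<union> \<T>1 \<union> \<T>2. L \<subseteq> B} = \<T>2"
      using d by (intro Set.set_eqI, metis (no_types, lifting) Un_iff mem_Collect_eq)+
    then show "(case case p of (H, \<T>1, \<T>2) \<Rightarrow> H \<union> \<T>1 \<union> \<T>2 of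
        \<T> \<Rightarrow> ({L \<in> \<T>. \<not> L \<subseteq> A \<and> \<not> L \<subseteq> B}, {L \<in> \<T>. L \<subseteq> A}, {L \<in> \<T>. L \<subseteq> B})) = p"
      unfolding p by simp
    have U: "\<Union>\<T>1 = A - \<Union>H" "\<Union>\<T>2 = B - \<Union>H" "\<Union>H \<subseteq> A \<union> B"
      and D: "disjoint \<T>1" "disjoint \<T>2" "disjoint H"
      and sub: "H \<union> \<T>1 \<union> \<T>2 \<subseteq> lozenges"
      using T H by (simp_all add: tilings_iff crossings_def Sup_le_iff)
    have "disjoint (H \<union> \<T>1)"
      using D U(1) by (intro disjoint_union) auto
    moreover have "\<Union>(H \<union> \<T>1) \<inter> \<Union>\<T>2 = {}"
      unfolding Union_Un_distrib U(1,2) using AB by blast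
    ultimately have "disjoint (H \<union> \<T>1 \<union> \<T>2)"
      using D(2) by - (rule disjoint_union)
    moreover have "\<Union>(H \<union> \<T>1 \<union> \<T>2) = A \<union> B"
      unfolding Union_Un_distrib U(1,2) using U(3) by blast
    ultimately show "(case p of (H, \<T>1, \<T>2) \<Rightarrow> H \<union> \<T>1 \<union> \<T>2) \<in> tilings (A \<union> B)"
      unfolding p tilings_iff using sub by simp
  qed
  also have "\<dots> = (\<Sum>H\<in>crossings A B. \<Sum>(\<T>1, \<T>2)\<in>tilings (A - \<Union>H) \<times> tilings (B - \<Union>H). prod w H * prod w \<T>1 * prod w \<T>2)"
    using fin assms by (subst sum.Sigma) (auto simp: finite_tilings case_prod_unfold)
  also have "\<dots> = (\<Sum>H\<in>crossings A B. prod w H * (\<Sum>\<T>\<in>tilings (A - \<Union>H). prod w \<T>) * (\<Sum>\<T>\<in>tilings (B - \<Union>H). prod w \<T>))"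
    by (intro sum.cong refl)
       (simp add: sum.cartesian_product[symmetric] sum_distrib_left sum_distrib_right mult.assoc, rule sum.swap)
  finally show ?thesis .
qed

section \<open>Columns of the trapezoid and removal of the rightmost one\<close>

definition tris :: "point set set" where
  "tris = {rtri a j | a j. True} \<union> {ltri a j | a j. True}"

text \<open>The regions below consist of triangles with natural column and label, so they can be
  compared through the membership rules for \<open>rtri\<close> and \<open>ltri\<close>.\<close>

lemma tri_set_eqI:
  assumes "X \<subseteq> tris" "Y \<subseteq> tris"
    and "\<And>a j. rtri a j \<in> X \<longleftrightarrow> rtri a j \<in> Y" "\<And>a j. ltri a j \<in> X \<longleftrightarrow> ltri a j \<in> Y"
  shows "X = Y"
proof (rule Set.set_eqI)
  fix t
  show "t \<in> X \<longleftrightarrow> t \<in> Y"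
  proof (cases "t \<in> tris")
    case True
    then consider a j where "t = rtri a j" | a j where "t = ltri a j" by (auto simp: tris_def)
    then show ?thesis using assms(3,4) by cases simp_all
  qed (use assms(1,2) in auto)
qed

text \<open>A horizontal lozenge across the line between two columns; the labelling of triangles is
  chosen such that both halves have the same label.\<close>

definition straddling :: "nat \<Rightarrow> nat \<Rightarrow> point set set" where
  "straddling a j = {ltri a j, rtri (Suc a) j}"

lemma straddling_eq_iff [simp]: "straddling a j = straddling b k \<longleftrightarrow> a = b \<and> j = k"
  by (auto simp: straddling_def doubleton_eq_iff)

lemma tri_lozenges:
  "{rtri a j, ltri a j} \<in> lozenges" "{rtri a j, ltri a (Suc j)} \<in> lozenges" "straddling a j \<in> lozenges"
  using lozengeI(1)[of "int a" "int j - int a - 1"] lozengeI(2)[of "int a" "int j - int a - 1"]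
    lozengeI(3)[of "int a" "int j - int a - 1"]
  by (simp_all add: rtri_def ltri_def straddling_def algebra_simps)

text \<open>One triangle of the lozenge fixes natural coordinates, and the other is then determined
  by the type. Negative and positive lozenges stay within a column; only horizontal ones change
  it.\<close>

lemma tri_lozenge_cases:
  assumes "L \<in> lozenges" "L \<subseteq> tris"
  obtains a j where "L = {rtri a j, ltri a j}"
  | a j where "L = {rtri a j, ltri a (Suc j)}"
  | a j where "L = straddling a j"
  using assms(1)
proof (cases rule: lozenge_cases)
  case (negative a b)
  then obtain a' j where "right_tri a b = rtri a' j"
    using assms(2) by (auto simp: tris_def ltri_def)
  then have "L = {rtri a' j, ltri a' j}"
    using negative by (simp add: rtri_def ltri_def)
  then show ?thesis using that by blast
next
  case (positive a b)
  then obtain a' j where "right_tri a b = rtri a' j"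
    using assms(2) by (auto simp: tris_def ltri_def)
  then have "L = {rtri a' j, ltri a' (Suc j)}"
    using positive by (simp add: rtri_def ltri_def)
  then show ?thesis using that by blast
next
  case (horizontal a b)
  then obtain a' j where "left_tri a b = ltri a' j"
    using assms(2) by (auto simp: tris_def rtri_def)
  then have "L = straddling a' j"
    using horizontal by (simp add: rtri_def ltri_def straddling_def add.commute[of 1])
  then show ?thesis using that by blast
qed

lemma lozenge_weight_tri:
  "lozenge_weight m x {rtri a j, ltri a j} = x (m - Suc a + 1)"
  "lozenge_weight m x {rtri a j, ltri a (Suc j)} = 1"
  "lozenge_weight m x (straddling a j) = 1"
proof -
  \<comment> \<open>\<open>nat\<close> and natural subtraction truncate alike, so this holds for
    every \<open>a\<close>.\<close>
  have "nat (int m - int a - 1) = m - Suc a" by simp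
  then show "lozenge_weight m x {rtri a j, ltri a j} = x (m - Suc a + 1)"
    unfolding rtri_def ltri_def lozenge_weight_same_label by simp
  show "lozenge_weight m x {rtri a j, ltri a (Suc j)} = 1"
    using not_negative_positive[of "int a" "int j - int a - 1"]
    by (simp add: lozenge_weight_def rtri_def ltri_def algebra_simps)
  show "lozenge_weight m x (straddling a j) = 1"
    using not_negative_horizontal[of "int a" "int j - int a - 1"]
    by (simp add: lozenge_weight_def rtri_def ltri_def straddling_def algebra_simps)
qed

definition strip :: "nat \<Rightarrow> nat set \<Rightarrow> nat set \<Rightarrow> point set set" where
  "strip a C D = rtri a ` C \<union> ltri a ` D"

lemma strip_subset_tris: "strip a C D \<subseteq> tris"
  by (auto simp: strip_def tris_def)

lemma tri_in_strip [simp]: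
  "rtri b j \<in> strip a C D \<longleftrightarrow> b = a \<and> j \<in> C" "ltri b j \<in> strip a C D \<longleftrightarrow> b = a \<and> j \<in> D"
  by (auto simp: strip_def)

lemma dented_subset_tris: "dented_trapezoid N m P P' \<subseteq> tris"
  by (auto simp: dented_trapezoid_def trapezoid_conv_tri tris_def)

lemma tri_in_dented [simp]:
  "rtri a j \<in> dented_trapezoid N (Suc m) P P' \<longleftrightarrow> a \<le> m \<and> j \<in> {1..N + a} \<and> \<not> (a = 0 \<and> j \<in> P')"
  "ltri a j \<in> dented_trapezoid N (Suc m) P P' \<longleftrightarrow> a \<le> m \<and> j \<in> {1..N + a + 1} \<and> \<not> (a = m \<and> j \<in> P)"
  by (auto simp: dented_trapezoid_def trapezoid_conv_tri left_side_tri_conv right_side_tri_conv)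

lemma tri_in_straddling [simp]:
  "rtri b i \<in> straddling a j \<longleftrightarrow> b = Suc a \<and> i = j"
  "ltri b i \<in> straddling a j \<longleftrightarrow> b = a \<and> i = j"
  by (auto simp: straddling_def)

text \<open>The dents on the right all lie in the last column and those on the left in column 0,
  which is a different column here.\<close>

lemma dented_trapezoid_Suc_Suc:
  "dented_trapezoid N (Suc (Suc k)) P P' =
     dented_trapezoid N (Suc k) {} P' \<union> strip (Suc k) {1..N + Suc k} ({1..N + Suc (Suc k)} - P)"
proof (rule tri_set_eqI)
  show "dented_trapezoid N (Suc k) {} P' \<union> strip (Suc k) {1..N + Suc k} ({1..N + Suc (Suc k)} - P) \<subseteq> tris"
    using dented_subset_tris strip_subset_tris by blast
qed (auto simp: dented_subset_tris le_Suc_eq)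

lemma dented_trapezoid_1:
  "dented_trapezoid N (Suc 0) P P' = strip 0 ({1..N} - P') ({1..Suc N} - P)"
  by (rule tri_set_eqI) (auto simp: dented_subset_tris strip_subset_tris)

text \<open>Only horizontal lozenges cross a vertical line, and lozenges at different labels are
  disjoint. A crossing set therefore amounts to a set of labels.\<close>

lemma crossings_dented_strip:
  "crossings (dented_trapezoid N (Suc k) {} P') (strip (Suc k) {1..N + Suc k} D)
     = (\<lambda>Q. straddling k ` Q) ` Pow {1..N + Suc k}" (is "crossings ?A ?B = _")
proof (intro Set.set_eqI iffI)
  fix H assume "H \<in> (\<lambda>Q. straddling k ` Q) ` Pow {1..N + Suc k}"
  then obtain Q where H: "H = straddling k ` Q" and Q: "Q \<subseteq> {1..N + Suc k}" by auto
  have *: "L \<in> lozenges" "L \<subseteq> ?A \<union> ?B \<and> \<not> L \<subseteq> ?A \<and> \<not> L \<subseteq> ?B" if "L \<in> H" for L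
    using that Q tri_lozenges(3) by (auto simp: H) (auto simp: straddling_def)
  have "disjoint H"
    unfolding H by (auto simp: pairwise_def disjnt_def) (auto simp: straddling_def)
  then show "H \<in> crossings ?A ?B"
    unfolding crossings_def by (intro CollectI conjI[OF subsetI conjI[OF _ ballI]] *)
next
  fix H assume H: "H \<in> crossings ?A ?B"
  then have "H \<subseteq> lozenges \<and> disjoint H \<and> (\<forall>L\<in>H. L \<subseteq> ?A \<union> ?B \<and> \<not> L \<subseteq> ?A \<and> \<not> L \<subseteq> ?B)"
    unfolding crossings_def mem_Collect_eq .
  note HH = this[THEN conjunct1] this[THEN conjunct2, THEN conjunct2]
  have "\<exists>j\<in>{1..N + Suc k}. L = straddling k j" if "L \<in> H" for L
  proof -
    have L: "L \<in> lozenges" "L \<subseteq> ?A \<union> ?B" "\<not> L \<subseteq> ?A" "\<not> L \<subseteq> ?B"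
      using subsetD[OF HH(1) that] HH(2)[rule_format, OF that] by simp_all
    have "L \<subseteq> tris"
      using L(2) by (rule subset_trans) (intro Un_least dented_subset_tris strip_subset_tris)
    with L(1) show ?thesis
    proof (cases rule: tri_lozenge_cases)
      case (1 a j)
      with L(2-4) show ?thesis by auto
    next
      case (2 a j)
      with L(2-4) show ?thesis by auto
    next
      case (3 a j)
      with L(2-4) show ?thesis by (auto simp: straddling_def)
    qed
  qed
  then have "H = straddling k ` {j \<in> {1..N + Suc k}. straddling k j \<in> H}"
    by (intro Set.set_eqI iffI) (metis (no_types, lifting) image_eqI mem_Collect_eq, auto)
  then show "H \<in> (\<lambda>Q. straddling k ` Q) ` Pow {1..N + Suc k}" by blast
qed

lemma finite_dented: "finite (dented_trapezoid N m P P')"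
  unfolding dented_trapezoid_def by (intro finite_Diff finite_trapezoid)

text \<open>Weights are indexed by the distance from the right side, so without the last column
  every index drops by one; shifting \<open>x\<close> compensates for this.\<close>

lemma lozenge_weight_Suc:
  assumes "L \<in> lozenges" "L \<subseteq> dented_trapezoid N (Suc k) P P'"
  shows "lozenge_weight (Suc (Suc k)) x L = lozenge_weight (Suc k) (\<lambda>i. x (Suc i)) L"
proof -
  from assms have "L \<subseteq> tris" using dented_subset_tris by blast
  with assms(1) show ?thesis
  proof (cases rule: tri_lozenge_cases)
    case (1 a j)
    with assms(2) have "a \<le> k" by auto
    then show ?thesis unfolding 1 lozenge_weight_tri by (simp add: Suc_diff_le)
  qed (simp_all add: lozenge_weight_tri)
qed

text \<open>\<open>Q\<close> holds the labels of the horizontal lozenges across the cut. They have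
  weight 1 and leave dents at \<open>Q\<close> on both sides of the cut: in the shorter trapezoid
  and in the last column.\<close>

lemma tiling_sum_remove_strip:
  "tiling_sum (Suc (Suc k)) x (dented_trapezoid N (Suc (Suc k)) P P') =
    (\<Sum>Q\<in>Pow {1..N + Suc k}. tiling_sum (Suc k) (\<lambda>i. x (Suc i)) (dented_trapezoid N (Suc k) Q P')
       * tiling_sum (Suc (Suc k)) x (strip (Suc k) ({1..N + Suc k} - Q) ({1..N + Suc (Suc k)} - P)))"
proof -
  let ?w = "lozenge_weight (Suc (Suc k)) x"
  let ?A = "dented_trapezoid N (Suc k) {} P'"
  let ?B = "strip (Suc k) {1..N + Suc k} ({1..N + Suc (Suc k)} - P)"
  have inj: "inj_on (\<lambda>Q. straddling k ` Q) (Pow {1..N + Suc k})"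
    by (rule inj_on_image_Pow) (auto simp: inj_on_def)
  have A: "?A - \<Union>(straddling k ` Q) = dented_trapezoid N (Suc k) Q P'" for Q
  proof (rule tri_set_eqI)
    show "?A - \<Union>(straddling k ` Q) \<subseteq> tris"
      using dented_subset_tris by (rule subset_trans[OF Diff_subset])
  qed (auto simp: dented_subset_tris)
  have B: "?B - \<Union>(straddling k ` Q) = strip (Suc k) ({1..N + Suc k} - Q) ({1..N + Suc (Suc k)} - P)" for Q
  proof (rule tri_set_eqI)
    show "?B - \<Union>(straddling k ` Q) \<subseteq> tris"
      using strip_subset_tris by (rule subset_trans[OF Diff_subset])
  qed (auto simp: strip_subset_tris)
  have w1: "prod ?w (straddling k ` Q) = 1" for Q
    by (rule prod.neutral) (auto simp: lozenge_weight_tri)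
  have wA: "(\<Sum>\<T>\<in>tilings R. prod ?w \<T>) = tiling_sum (Suc k) (\<lambda>i. x (Suc i)) R"
    if "R = dented_trapezoid N (Suc k) Q P'" for Q R
    unfolding tiling_sum_def
  proof (intro sum.cong prod.cong refl)
    fix \<T> L assume "\<T> \<in> tilings R" "L \<in> \<T>"
    then have "L \<in> lozenges" "L \<subseteq> R" unfolding tilings_iff by blast+
    then show "?w L = lozenge_weight (Suc k) (\<lambda>i. x (Suc i)) L"
      using that lozenge_weight_Suc by blast
  qed
  have "rtri a j \<notin> ?A \<inter> ?B" "ltri a j \<notin> ?A \<inter> ?B" for a j by auto
  then have "?A \<inter> ?B = {}"
    by (intro tri_set_eqI) (use dented_subset_tris in blast, auto)
  then have "tiling_sum (Suc (Suc k)) x (dented_trapezoid N (Suc (Suc k)) P P') =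
    (\<Sum>H\<in>crossings ?A ?B. prod ?w H * (\<Sum>\<T>\<in>tilings (?A - \<Union>H). prod ?w \<T>) * (\<Sum>\<T>\<in>tilings (?B - \<Union>H). prod ?w \<T>))"
    unfolding dented_trapezoid_Suc_Suc tiling_sum_def
    by (intro sum_tilings_Un finite_dented) (auto simp: strip_def)
  also have "\<dots> = (\<Sum>Q\<in>Pow {1..N + Suc k}. tiling_sum (Suc k) (\<lambda>i. x (Suc i)) (dented_trapezoid N (Suc k) Q P')
       * tiling_sum (Suc (Suc k)) x (strip (Suc k) ({1..N + Suc k} - Q) ({1..N + Suc (Suc k)} - P)))"
    unfolding crossings_dented_strip sum.reindex[OF inj] comp_def A B w1 wA[OF refl]
    by (simp add: tiling_sum_def)
  finally show ?thesis .
qed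

text \<open>In a single column the left-pointing triangle labelled \<open>c i\<close> is paired with
  the right-pointing one labelled \<open>c i\<close> (negative, \<open>\<kappa> i = 0\<close>) or
  \<open>c i - 1\<close> (positive, \<open>\<kappa> i = 1\<close>). The conditions on \<kappa> say
  that each triangle of \<open>C\<close> is used exactly once.\<close>

lemma tiling_sum_strip:
  fixes c :: "nat \<Rightarrow> nat"
  assumes c: "inj_on c {..<n}" "\<And>i. i < n \<Longrightarrow> 0 < c i"
  shows "tiling_sum (Suc a) x (strip a C (c ` {..<n})) =
    (\<Sum>\<kappa> | \<kappa> \<in> {..<n} \<rightarrow>\<^sub>E {0, 1} \<and> inj_on (\<lambda>i. c i - \<kappa> i) {..<n} \<and> (\<lambda>i. c i - \<kappa> i) ` {..<n} = C.
       \<Prod>i<n. if \<kappa> i = 0 then x 1 else 1)"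
proof -
  define loz where "loz = (\<lambda>\<kappa> i. {rtri a (c i - \<kappa> i), ltri a (c i)})"
  let ?R = "strip a C (c ` {..<n})"
  let ?K = "{\<kappa> \<in> {..<n} \<rightarrow>\<^sub>E {0, 1}. inj_on (\<lambda>i. c i - \<kappa> i) {..<n} \<and> (\<lambda>i. c i - \<kappa> i) ` {..<n} = C}"
  have inj_loz: "i = j" if "loz \<kappa> i = loz \<kappa>' j" "i < n" "j < n" for \<kappa> \<kappa>' i j
    using that c(1) by (auto simp: loz_def doubleton_eq_iff inj_on_def)
  have bound: "\<kappa> i = 0 \<or> \<kappa> i = 1" if "\<kappa> \<in> ?K" "i < n" for \<kappa> i
    using that by auto
  have "inj_on (\<lambda>\<kappa>. loz \<kappa> ` {..<n}) ?K"
  proof (rule inj_onI)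
    fix \<kappa> \<kappa>' assume K: "\<kappa> \<in> ?K" "\<kappa>' \<in> ?K" and eq: "loz \<kappa> ` {..<n} = loz \<kappa>' ` {..<n}"
    have "\<kappa> i = \<kappa>' i" if i: "i < n" for i
    proof -
      from eq i have "loz \<kappa> i \<in> loz \<kappa>' ` {..<n}" by blast
      then obtain j where j: "j < n" "loz \<kappa> i = loz \<kappa>' j" by blast
      with inj_loz i have "loz \<kappa> i = loz \<kappa>' i" by blast
      then have "c i - \<kappa> i = c i - \<kappa>' i" by (simp add: loz_def doubleton_eq_iff)
      \<comment> \<open>Positivity of \<open>c i\<close> matters: the truncated \<open>0 - 1\<close>
        would not distinguish the two choices.\<close>
      with bound[OF K(1) i] bound[OF K(2) i] c(2)[OF i] show ?thesis by auto
    qed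
    with K show "\<kappa> = \<kappa>'" by (intro PiE_ext[of \<kappa> "{..<n}" "\<lambda>_. {0, 1}" \<kappa>']) auto
  qed
  moreover have "tilings ?R = (\<lambda>\<kappa>. loz \<kappa> ` {..<n}) ` ?K"
  proof (intro Set.set_eqI iffI)
    fix \<T> assume "\<T> \<in> (\<lambda>\<kappa>. loz \<kappa> ` {..<n}) ` ?K"
    then obtain \<kappa> where \<kappa>: "\<kappa> \<in> ?K" and \<T>: "\<T> = loz \<kappa> ` {..<n}" by blast
    have "loz \<kappa> i \<in> lozenges" if "i < n" for i
      using bound[OF \<kappa> that] c(2)[OF that] tri_lozenges(1)[of a "c i"] tri_lozenges(2)[of a "c i - 1"]
      by (auto simp: loz_def)
    moreover have "\<Union>\<T> = ?R"
    proof -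
      have "C = (\<lambda>i. c i - \<kappa> i) ` {..<n}" using \<kappa> by simp
      then show ?thesis unfolding \<T> loz_def strip_def by auto
    qed
    moreover have "disjoint \<T>"
      unfolding \<T>
    proof (rule pairwise_imageI)
      fix i j assume ij: "i \<in> {..<n}" "j \<in> {..<n}" "i \<noteq> j"
      moreover have "inj_on (\<lambda>i. c i - \<kappa> i) {..<n}" using \<kappa> by simp
      ultimately have "c i - \<kappa> i \<noteq> c j - \<kappa> j" "c i \<noteq> c j"
        using c(1) unfolding inj_on_def by metis+
      then show "disjnt (loz \<kappa> i) (loz \<kappa> j)"
        by (simp add: loz_def disjnt_def)
    qed
    ultimately show "\<T> \<in> tilings ?R"
      unfolding tilings_iff \<T> by (auto simp del: Union_iff)
  next
    fix \<T> assume \<T>: "\<T> \<in> tilings ?R"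
    note uniq = tilings_unique[OF \<T>]
    have cover: "\<Union>\<T> = ?R" using \<T> by (simp add: tilings_iff)
    have shape: "\<exists>j k. L = {rtri a (j - k), ltri a j} \<and> (k = 0 \<or> k = 1)" if "L \<in> \<T>" for L
    proof -
      from \<T> that have L: "L \<in> lozenges" "L \<subseteq> ?R" unfolding tilings_iff by blast+
      have "L \<subseteq> tris" using L(2) strip_subset_tris by (rule subset_trans)
      with L(1) show ?thesis
      proof (cases rule: tri_lozenge_cases)
        case (1 b j)
        with L(2) show ?thesis by (intro exI[of _ j] exI[of _ 0]) simp
      next
        case (2 b j)
        with L(2) show ?thesis by (intro exI[of _ "Suc j"] exI[of _ 1]) simp
      next
        case (3 b j)
        with L(2) have "ltri b j \<in> ?R" "rtri (Suc b) j \<in> ?R"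
          by (simp_all only: straddling_def insert_subset)
        then have "b = a" "Suc b = a" unfolding tri_in_strip by blast+
        then show ?thesis by simp
      qed
    qed
    have "\<exists>k. (k = 0 \<or> k = 1) \<and> {rtri a (c i - k), ltri a (c i)} \<in> \<T>" if "i < n" for i
    proof -
      from that have "ltri a (c i) \<in> ?R" by simp
      with tilings_cover[OF \<T>] obtain L where L: "L \<in> \<T>" "ltri a (c i) \<in> L" by blast
      from shape[OF L(1)] obtain j k where "L = {rtri a (j - k), ltri a j}" "k = 0 \<or> k = 1" by blast
      with L show ?thesis by auto
    qed
    then obtain \<mu> where \<mu>: "\<And>i. i < n \<Longrightarrow> (\<mu> i = 0 \<or> \<mu> i = 1) \<and> {rtri a (c i - \<mu> i), ltri a (c i)} \<in> \<T>"
      by metis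
    define \<kappa> where "\<kappa> = restrict \<mu> {..<n}"
    have \<kappa>: "\<kappa> i = 0 \<or> \<kappa> i = 1" "loz \<kappa> i \<in> \<T>" if "i < n" for i
      using \<mu>[OF that] that by (simp_all add: \<kappa>_def loz_def)
    have "\<exists>i<n. L = loz \<kappa> i" if L: "L \<in> \<T>" for L
    proof -
      from shape[OF L] obtain j where j: "ltri a j \<in> L" by blast
      with L cover have "ltri a j \<in> ?R" by blast
      then obtain i where i: "i < n" "j = c i" by auto
      have "ltri a j \<in> loz \<kappa> i" by (simp add: loz_def i(2))
      then show ?thesis using uniq[OF L \<kappa>(2)[OF i(1)] j] i(1) by blast
    qed
    then have eq: "\<T> = loz \<kappa> ` {..<n}" using \<kappa>(2) by blast
    have "inj_on (\<lambda>i. c i - \<kappa> i) {..<n}"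
    proof (rule inj_onI)
      fix i j assume ij: "i \<in> {..<n}" "j \<in> {..<n}" "c i - \<kappa> i = c j - \<kappa> j"
      then have "rtri a (c i - \<kappa> i) \<in> loz \<kappa> i" "rtri a (c i - \<kappa> i) \<in> loz \<kappa> j"
        by (simp_all add: loz_def)
      with uniq \<kappa>(2) ij have "loz \<kappa> i = loz \<kappa> j" by (metis lessThan_iff)
      then show "i = j" using inj_loz ij by blast
    qed
    moreover have "(\<lambda>i. c i - \<kappa> i) ` {..<n} = C"
    proof (rule Set.set_eqI)
      fix j
      have "j \<in> C \<longleftrightarrow> rtri a j \<in> \<Union>(loz \<kappa> ` {..<n})" using cover eq by simp
      also have "\<dots> \<longleftrightarrow> j \<in> (\<lambda>i. c i - \<kappa> i) ` {..<n}" by (auto simp: loz_def)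
      finally show "j \<in> (\<lambda>i. c i - \<kappa> i) ` {..<n} \<longleftrightarrow> j \<in> C" by simp
    qed
    moreover have "\<kappa> \<in> {..<n} \<rightarrow>\<^sub>E {0, 1}"
      using \<kappa>(1) by (auto simp: \<kappa>_def)
    ultimately show "\<T> \<in> (\<lambda>\<kappa>. loz \<kappa> ` {..<n}) ` ?K"
      using eq by blast
  qed
  moreover have "prod (lozenge_weight (Suc a) x) (loz \<kappa> ` {..<n}) = (\<Prod>i<n. if \<kappa> i = 0 then x 1 else 1)"
    if "\<kappa> \<in> ?K" for \<kappa>
  proof -
    have "inj_on (loz \<kappa>) {..<n}" using inj_loz by (intro inj_onI) auto
    then have "prod (lozenge_weight (Suc a) x) (loz \<kappa> ` {..<n}) = (\<Prod>i<n. lozenge_weight (Suc a) x (loz \<kappa> i))"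
      by (simp add: prod.reindex)
    also have "\<dots> = (\<Prod>i<n. if \<kappa> i = 0 then x 1 else 1)"
    proof (rule prod.cong[OF refl])
      fix i assume "i \<in> {..<n}"
      then have i: "i < n" by simp
      show "lozenge_weight (Suc a) x (loz \<kappa> i) = (if \<kappa> i = 0 then x 1 else 1)"
        using bound[OF that i] c(2)[OF i] lozenge_weight_tri(1)[of "Suc a" x a "c i"]
          lozenge_weight_tri(2)[of "Suc a" x a "c i - 1"]
        by (auto simp: loz_def)
    qed
    finally show ?thesis .
  qed
  ultimately show ?thesis
    unfolding tiling_sum_def by (simp add: sum.reindex)
qed

section \<open>The determinant formula for dented trapezoids\<close>

text \<open>The weighted number of ways in which one particle can rise by \<open>k\<close> in \<open>m\<close> columns; the argument
  is an integer so that differences of labels need not be truncated. As \<open>x\<close> is indexed from the right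
  side, peeling off the rightmost column shifts it.\<close>

fun path_sum :: "nat \<Rightarrow> (nat \<Rightarrow> 'a::comm_ring_1) \<Rightarrow> int \<Rightarrow> 'a" where
  "path_sum 0 x k = (if k = 0 then 1 else 0)"
| "path_sum (Suc m) x k =
     x 1 * path_sum m (\<lambda>i. x (Suc i)) k + path_sum m (\<lambda>i. x (Suc i)) (k - 1)"

lemma path_sum_eq_0: "k < 0 \<or> int m < k \<Longrightarrow> path_sum m x k = 0"
  by (induction m x k rule: path_sum.induct) auto

lemma path_sum_top: "path_sum m x (int m) = 1"
  by (induction m arbitrary: x) (simp_all add: path_sum_eq_0)

text \<open>\<open>path_sum m x k\<close> is the coefficient of \<open>t ^ k\<close> in the product
  of the factors \<open>x i + t\<close>; this is the value of that product at
  \<open>t = 1\<close>.\<close>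

lemma sum_path_sum: "(\<Sum>k\<le>m. path_sum m x (int k)) = (\<Prod>i=1..m. 1 + x i)"
proof (induction m arbitrary: x)
  case (Suc m)
  let ?p = "\<lambda>k. path_sum m (\<lambda>i. x (Suc i)) k"
  have "(\<Sum>k\<le>Suc m. path_sum (Suc m) x (int k)) = x 1 * (\<Sum>k\<le>Suc m. ?p (int k)) + (\<Sum>k\<le>Suc m. ?p (int k - 1))"
    by (simp only: path_sum.simps sum.distrib sum_distrib_left)
  also have "(\<Sum>k\<le>Suc m. ?p (int k)) = (\<Sum>k\<le>m. ?p (int k))"
    by (simp add: path_sum_eq_0)
  also have "(\<Sum>k\<le>Suc m. ?p (int k - 1)) = (\<Sum>k\<le>m. ?p (int k))"
    by (subst sum.atMost_Suc_shift) (simp add: path_sum_eq_0)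
  also have "x 1 * (\<Sum>k\<le>m. ?p (int k)) + (\<Sum>k\<le>m. ?p (int k)) = (1 + x 1) * (\<Prod>i=1..m. 1 + x (Suc i))"
    by (simp add: Suc.IH algebra_simps)
  also have "\<dots> = (1 + x 1) * (\<Prod>i=Suc 1..Suc m. 1 + x i)"
    by (simp only: prod.shift_bounds_cl_Suc_ivl)
  also have "\<dots> = (\<Prod>i=1..Suc m. 1 + x i)"
    by (rule prod.atLeast_Suc_atMost[symmetric]) simp
  finally show ?case .
qed simp

text \<open>Every row is expanded by the recursion of \<open>path_sum\<close>, where
  \<open>\<kappa> i\<close> tells whether particle \<open>i\<close> rises in the rightmost column.
  Colliding particles give equal rows. A position outside \<open>{1..N + m}\<close> gives a zero
  row, since its distance from each \<open>b j\<close> is negative or exceeds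
  \<open>m\<close>.\<close>

lemma fdet_path_sum_Suc:
  fixes c b :: "nat \<Rightarrow> nat"
  assumes c: "\<And>i. i < n \<Longrightarrow> c i \<in> {1..N + Suc m}" and b: "\<And>j. j < n \<Longrightarrow> b j \<in> {1..N}"
  shows "fdet n (\<lambda>i j. path_sum (Suc m) x (int (c i) - int (b j))) =
    (\<Sum>\<kappa> | \<kappa> \<in> {..<n} \<rightarrow>\<^sub>E {0, 1} \<and> inj_on (\<lambda>i. c i - \<kappa> i) {..<n} \<and> (\<lambda>i. c i - \<kappa> i) ` {..<n} \<subseteq> {1..N + m}.
       (\<Prod>i<n. if \<kappa> i = 0 then x 1 else 1)
         * fdet n (\<lambda>i j. path_sum m (\<lambda>i. x (Suc i)) (int (c i - \<kappa> i) - int (b j))))"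
    (is "_ = (\<Sum>\<kappa>\<in>?K. ?w \<kappa> * ?d \<kappa>)")
proof -
  let ?p = "path_sum m (\<lambda>i. x (Suc i))"
  have "fdet n (\<lambda>i j. path_sum (Suc m) x (int (c i) - int (b j))) =
      fdet n (\<lambda>i j. \<Sum>k\<in>{0, 1::nat}. (if k = 0 then x 1 else 1) * ?p (int (c i - k) - int (b j)))"
    \<comment> \<open>As \<open>c i\<close> is at least 1, the subtraction \<open>c i - k\<close> is
      not truncated.\<close>
    using c by (intro fdet_cong) (fastforce simp: algebra_simps of_nat_diff)
  also have "\<dots> = (\<Sum>\<kappa>\<in>{..<n} \<rightarrow>\<^sub>E {0, 1}. ?w \<kappa> * ?d \<kappa>)"
    by (subst fdet_sum_rows) (simp_all only: fdet_scale_rows finite.intros)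
  also have "\<dots> = (\<Sum>\<kappa>\<in>?K. ?w \<kappa> * ?d \<kappa>)"
  proof (rule sum.mono_neutral_right)
    show "finite ({..<n} \<rightarrow>\<^sub>E {0, 1::nat})" by (intro finite_PiE) auto
    show "\<forall>\<kappa>\<in>({..<n} \<rightarrow>\<^sub>E {0, 1}) - ?K. ?w \<kappa> * ?d \<kappa> = 0"
    proof
      fix \<kappa> :: "nat \<Rightarrow> nat" assume "\<kappa> \<in> ({..<n} \<rightarrow>\<^sub>E {0, 1}) - ?K"
      then consider "\<not> inj_on (\<lambda>i. c i - \<kappa> i) {..<n}" | i where "i < n" "c i - \<kappa> i \<notin> {1..N + m}"
        by blast
      then have "?d \<kappa> = 0"
      proof cases
        case 1
        then obtain i i' where "i < n" "i' < n" "i \<noteq> i'" "c i - \<kappa> i = c i' - \<kappa> i'"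
          by (auto simp: inj_on_def)
        then show ?thesis by (intro fdet_equal_rows[of i n i']) simp_all
      next
        case (2 i)
        show ?thesis
        proof (rule fdet_zero_row[OF 2(1)])
          fix j assume "j < n"
          from b[OF this] 2(2) show "?p (int (c i - \<kappa> i) - int (b j)) = 0"
            by (intro path_sum_eq_0) auto
        qed
      qed
      then show "?w \<kappa> * ?d \<kappa> = 0" by simp
    qed
  qed auto
  finally show ?thesis .
qed

text \<open>Without columns no particle moves, and the entries are the indicators of
  \<open>c i = b j\<close>. Increasing enumerations of the same set coincide, which gives the
  identity matrix; otherwise some row vanishes.\<close>

lemma fdet_path_sum_0:
  assumes "strict_mono_on {..<n} c" "strict_mono_on {..<n} b"
  shows "fdet n (\<lambda>i j. path_sum 0 x (int (c i) - int (b j))) = (if c ` {..<n} = b ` {..<n} then 1 else 0)"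
proof (cases "c ` {..<n} \<subseteq> b ` {..<n}")
  case True
  have inj: "inj_on c {..<n}" "inj_on b {..<n}"
    using assms by (auto intro: strict_mono_on_imp_inj_on)
  then have eq: "c ` {..<n} = b ` {..<n}"
    using True by (intro card_subset_eq) (auto simp: card_image)
  have "sorted_list_of_set (f ` {..<n}) = map f [0..<n]" if "strict_mono_on {..<n} f" for f :: "nat \<Rightarrow> nat"
  proof (rule sorted_distinct_set_unique)
    show "sorted (map f [0..<n])"
      using that by (auto simp: sorted_iff_nth_mono_less strict_mono_on_def intro!: less_imp_le)
    show "distinct (map f [0..<n])"
      using strict_mono_on_imp_inj_on[OF that] by (simp add: distinct_map atLeast0LessThan)
  qed (auto simp: atLeast0LessThan)
  with assms eq have "map c [0..<n] = map b [0..<n]" by metis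
  then have cb: "c i = b i" if "i < n" for i using that by (simp add: list_eq_iff_nth_eq)
  have "fdet n (\<lambda>i j. path_sum 0 x (int (c i) - int (b j))) = fdet n (\<lambda>i j. if i = j then 1 else 0)"
    using inj(2) by (intro fdet_cong) (auto simp: cb inj_on_def)
  also have "\<dots> = 1"
    by (simp add: fdet_def one_mat_def[symmetric])
  finally show ?thesis using eq by simp
next
  case False
  then obtain i where i: "i < n" "c i \<notin> b ` {..<n}" by auto
  then have "fdet n (\<lambda>i j. path_sum 0 x (int (c i) - int (b j))) = 0"
    by (intro fdet_zero_row[of i]) auto
  with False show ?thesis by auto
qed

text \<open>Lowering integers in strict order by at most one can produce ties but no inversions, and
  injectivity excludes ties. The moved particles thus stay sorted, as the induction below
  requires.\<close>

lemma strict_mono_on_diff_01: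
  fixes c \<kappa> :: "nat \<Rightarrow> nat"
  assumes c: "strict_mono_on {..<n} c" and \<kappa>: "\<kappa> \<in> {..<n} \<rightarrow>\<^sub>E {0, 1}"
    and inj: "inj_on (\<lambda>i. c i - \<kappa> i) {..<n}"
  shows "strict_mono_on {..<n} (\<lambda>i. c i - \<kappa> i)"
proof (rule strict_mono_onI)
  fix i j assume ij: "i \<in> {..<n}" "j \<in> {..<n}" "i < j"
  from inj ij have "c i - \<kappa> i \<noteq> c j - \<kappa> j" unfolding inj_on_def by blast
  moreover have "c i < c j" using strict_mono_onD[OF c ij] .
  moreover have "\<kappa> j \<in> {0, 1}" using \<kappa> ij(2) by (rule PiE_mem)
  ultimately show "c i - \<kappa> i < c j - \<kappa> j" by auto
qed

text \<open>A Lindstroem-Gessel-Viennot determinant, with the particles at the labels that are not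
  dented. The induction removes the rightmost column, so \<open>c\<close> and \<open>x\<close> vary
  while the starting labels \<open>b\<close> stay fixed.\<close>

lemma tiling_sum_dented:
  assumes "strict_mono_on {..<n} c" "c ` {..<n} \<subseteq> {1..N + Suc m}"
    and b: "strict_mono_on {..<n} b" "b ` {..<n} \<subseteq> {1..N}"
  shows "tiling_sum (Suc m) x
      (dented_trapezoid N (Suc m) ({1..N + Suc m} - c ` {..<n}) ({1..N} - b ` {..<n}))
    = fdet n (\<lambda>i j. path_sum (Suc m) x (int (c i) - int (b j)))"
  using assms(1,2)
proof (induction m arbitrary: c x)
  case (0 c x)
  note c = "0.prems"
  let ?w = "\<lambda>\<kappa>. \<Prod>i<n. if \<kappa> i = 0 then x 1 else (1::'a)"
  let ?im = "\<lambda>\<kappa>. (\<lambda>i. c i - \<kappa> i) ` {..<n}"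
  let ?K = "{\<kappa>. \<kappa> \<in> {..<n} \<rightarrow>\<^sub>E {0, 1} \<and> inj_on (\<lambda>i. c i - \<kappa> i) {..<n} \<and> ?im \<kappa> \<subseteq> {1..N + 0}}"
  have finK: "finite ?K"
    by (rule finite_subset[of _ "{..<n} \<rightarrow>\<^sub>E {0, 1}"]) (auto intro: finite_PiE)
  have compl: "{1..N} - ({1..N} - b ` {..<n}) = b ` {..<n}" "{1..Suc N} - ({1..N + Suc 0} - c ` {..<n}) = c ` {..<n}"
    using b(2) c(2) by auto
  have "fdet n (\<lambda>i j. path_sum (Suc 0) x (int (c i) - int (b j))) =
      (\<Sum>\<kappa>\<in>?K. ?w \<kappa> * fdet n (\<lambda>i j. path_sum 0 (\<lambda>i. x (Suc i)) (int (c i - \<kappa> i) - int (b j))))"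
    using b(2) c(2) by (intro fdet_path_sum_Suc) blast+
  \<comment> \<open>No column remains to the left, so the moved particles must already be at the
    starting labels.\<close>
  also have "\<dots> = (\<Sum>\<kappa>\<in>?K. if ?im \<kappa> = b ` {..<n} then ?w \<kappa> else 0)"
  proof (rule sum.cong[OF refl])
    fix \<kappa> assume "\<kappa> \<in> ?K"
    then have "strict_mono_on {..<n} (\<lambda>i. c i - \<kappa> i)"
      using strict_mono_on_diff_01[OF c(1)] by blast
    from fdet_path_sum_0[OF this b(1), of "\<lambda>i. x (Suc i)"]
    show "?w \<kappa> * fdet n (\<lambda>i j. path_sum 0 (\<lambda>i. x (Suc i)) (int (c i - \<kappa> i) - int (b j))) =
        (if ?im \<kappa> = b ` {..<n} then ?w \<kappa> else 0)"
      by (simp only: if_distrib[of "(*) _"] mult_1_right mult_zero_right)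
  qed
  also have "\<dots> = (\<Sum>\<kappa> | \<kappa> \<in> ?K \<and> ?im \<kappa> = b ` {..<n}. ?w \<kappa>)"
    using finK by (subst sum.inter_filter[symmetric]) simp_all
  also have "{\<kappa>. \<kappa> \<in> ?K \<and> ?im \<kappa> = b ` {..<n}} =
      {\<kappa>. \<kappa> \<in> {..<n} \<rightarrow>\<^sub>E {0, 1} \<and> inj_on (\<lambda>i. c i - \<kappa> i) {..<n} \<and> ?im \<kappa> = b ` {..<n}}"
  proof -
    have "S \<subseteq> {1..N + 0}" if "S = b ` {..<n}" for S using that b(2) by simp
    then show ?thesis by (intro Collect_cong) blast
  qed
  also have "(\<Sum>\<kappa>\<in>\<dots>. ?w \<kappa>) = tiling_sum (Suc 0) x (strip 0 (b ` {..<n}) (c ` {..<n}))"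
    using c by (subst tiling_sum_strip) (auto intro: strict_mono_on_imp_inj_on)
  finally show ?case
    unfolding dented_trapezoid_1 compl ..
next
  case (Suc m c x)
  note c = "Suc.prems"
  let ?M = "N + Suc m" and ?x = "\<lambda>i. x (Suc i)"
  let ?w = "\<lambda>\<kappa>. \<Prod>i<n. if \<kappa> i = 0 then x 1 else (1::'a)"
  let ?im = "\<lambda>\<kappa>. (\<lambda>i. c i - \<kappa> i) ` {..<n}"
  let ?K = "{\<kappa>. \<kappa> \<in> {..<n} \<rightarrow>\<^sub>E {0, 1} \<and> inj_on (\<lambda>i. c i - \<kappa> i) {..<n} \<and> ?im \<kappa> \<subseteq> {1..?M}}"
  let ?T = "\<lambda>Q. tiling_sum (Suc m) ?x (dented_trapezoid N (Suc m) Q ({1..N} - b ` {..<n}))"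
  have finK: "finite ?K"
    by (rule finite_subset[of _ "{..<n} \<rightarrow>\<^sub>E {0, 1}"]) (auto intro: finite_PiE)
  have compl: "{1..N + Suc (Suc m)} - ({1..N + Suc (Suc m)} - c ` {..<n}) = c ` {..<n}"
    using c(2) by auto
  have "fdet n (\<lambda>i j. path_sum (Suc (Suc m)) x (int (c i) - int (b j))) =
      (\<Sum>\<kappa>\<in>?K. ?w \<kappa> * fdet n (\<lambda>i j. path_sum (Suc m) ?x (int (c i - \<kappa> i) - int (b j))))"
    using b(2) c(2) by (intro fdet_path_sum_Suc) blast+
  also have "\<dots> = (\<Sum>\<kappa>\<in>?K. ?w \<kappa> * ?T ({1..?M} - ?im \<kappa>))"
  proof (rule sum.cong[OF refl])
    fix \<kappa> assume "\<kappa> \<in> ?K"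
    then have "strict_mono_on {..<n} (\<lambda>i. c i - \<kappa> i)" "?im \<kappa> \<subseteq> {1..?M}"
      using strict_mono_on_diff_01[OF c(1)] by blast+
    from Suc.IH[OF this, of ?x]
    show "?w \<kappa> * fdet n (\<lambda>i j. path_sum (Suc m) ?x (int (c i - \<kappa> i) - int (b j))) =
        ?w \<kappa> * ?T ({1..?M} - ?im \<kappa>)"
      by (simp only:)
  qed
  \<comment> \<open>The moves are grouped by the labels \<open>Q\<close> left empty, which are the
    labels of the horizontal lozenges across the cut.\<close>
  also have "\<dots> = (\<Sum>Q\<in>Pow {1..?M}. \<Sum>\<kappa> | \<kappa> \<in> ?K \<and> {1..?M} - ?im \<kappa> = Q. ?w \<kappa> * ?T ({1..?M} - ?im \<kappa>))"
    by (rule sum.group[symmetric]) (use finK in auto)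
  also have "\<dots> = (\<Sum>Q\<in>Pow {1..?M}. ?T Q * tiling_sum (Suc (Suc m)) x (strip (Suc m) ({1..?M} - Q) (c ` {..<n})))"
  proof (rule sum.cong[OF refl])
    fix Q assume "Q \<in> Pow {1..?M}"
    then have "{\<kappa>. \<kappa> \<in> ?K \<and> {1..?M} - ?im \<kappa> = Q} =
        {\<kappa>. \<kappa> \<in> {..<n} \<rightarrow>\<^sub>E {0, 1} \<and> inj_on (\<lambda>i. c i - \<kappa> i) {..<n} \<and> ?im \<kappa> = {1..?M} - Q}"
      by (intro Collect_cong) auto
    then have "tiling_sum (Suc (Suc m)) x (strip (Suc m) ({1..?M} - Q) (c ` {..<n})) =
        (\<Sum>\<kappa> | \<kappa> \<in> ?K \<and> {1..?M} - ?im \<kappa> = Q. ?w \<kappa>)"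
      using c by (subst tiling_sum_strip) (auto intro: strict_mono_on_imp_inj_on)
    then show "(\<Sum>\<kappa> | \<kappa> \<in> ?K \<and> {1..?M} - ?im \<kappa> = Q. ?w \<kappa> * ?T ({1..?M} - ?im \<kappa>)) =
        ?T Q * tiling_sum (Suc (Suc m)) x (strip (Suc m) ({1..?M} - Q) (c ` {..<n}))"
      by (simp add: sum_distrib_left mult.commute)
  qed
  finally show ?case
    unfolding tiling_sum_remove_strip compl ..
qed

section \<open>Choices of one label per block\<close>

text \<open>The blocks are consecutive intervals: one label from each gives an increasing sequence,
  and the choice can be recovered from its image.\<close>

lemma block_choices:
  fixes s :: "nat \<Rightarrow> nat"
  assumes s: "s 0 = 0" "mono s"
  shows strict_mono_on_block_choice: "\<kappa> \<in> (\<Pi>\<^sub>E i\<in>{..<n}. {s i<..s (Suc i)}) \<Longrightarrow> strict_mono_on {..<n} \<kappa>"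
    and block_choice_subset: "\<kappa> \<in> (\<Pi>\<^sub>E i\<in>{..<n}. {s i<..s (Suc i)}) \<Longrightarrow> \<kappa> ` {..<n} \<subseteq> {1..s n}"
    and block_choice_Int: "\<kappa> \<in> (\<Pi>\<^sub>E i\<in>{..<n}. {s i<..s (Suc i)}) \<Longrightarrow> i < n \<Longrightarrow>
      \<kappa> ` {..<n} \<inter> {s i<..s (Suc i)} = {\<kappa> i}"
proof -
  assume \<kappa>: "\<kappa> \<in> (\<Pi>\<^sub>E i\<in>{..<n}. {s i<..s (Suc i)})"
  have bound: "s i < \<kappa> i" "\<kappa> i \<le> s (Suc i)" if "i < n" for i
    using PiE_mem[OF \<kappa>, of i] that by auto
  have le: "s (Suc i) \<le> s j" if "i < j" for i j
    using monoD[OF s(2), of "Suc i" j] that by simp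
  have less: "\<kappa> i < \<kappa> j" if "i < j" "j < n" for i j
    using bound(2)[of i] le[of i j] bound(1)[of j] that by simp
  then show "strict_mono_on {..<n} \<kappa>"
    by (intro strict_mono_onI) auto
  show "\<kappa> ` {..<n} \<subseteq> {1..s n}"
  proof
    fix t assume "t \<in> \<kappa> ` {..<n}"
    then obtain i where "i < n" "t = \<kappa> i" by auto
    with bound[of i] le[of i n] show "t \<in> {1..s n}" by simp
  qed
  show "\<kappa> ` {..<n} \<inter> {s i<..s (Suc i)} = {\<kappa> i}" if i: "i < n"
  proof -
    have "j = i" if "j < n" "s i < \<kappa> j" "\<kappa> j \<le> s (Suc i)" for j
    proof (rule ccontr)
      assume "j \<noteq> i"
      then consider "j < i" | "i < j" by linarith
      then show False
        by cases (use that bound[of j] le[of j i] le[of i j] in simp_all)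
    qed
    note uniq = this
    have "\<kappa> ` {..<n} \<inter> {s i<..s (Suc i)} \<subseteq> {\<kappa> i}"
    proof
      fix t assume "t \<in> \<kappa> ` {..<n} \<inter> {s i<..s (Suc i)}"
      then obtain j where j: "j < n" "t = \<kappa> j" "s i < \<kappa> j" "\<kappa> j \<le> s (Suc i)" by auto
      show "t \<in> {\<kappa> i}" using uniq[OF j(1,3,4)] j(2) by simp
    qed
    moreover have "\<kappa> i \<in> \<kappa> ` {..<n} \<inter> {s i<..s (Suc i)}"
      using bound[OF i] i by simp
    ultimately show ?thesis by blast
  qed
qed

lemma ex_block:
  fixes s :: "nat \<Rightarrow> nat"
  assumes "s 0 = 0" "t \<in> {1..s n}"
  shows "\<exists>i<n. t \<in> {s i<..s (Suc i)}"
  using assms(2)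
proof (induction n)
  case (Suc n)
  then show ?case
    by (cases "t \<le> s n") (auto intro: less_SucI)
qed (use assms(1) in simp)

text \<open>Block \<open>k\<close> has \<open>r k + 1\<close> labels, of which \<open>P\<close>
  contains \<open>r k\<close>, so exactly one is left out. Passing to the omitted labels makes the
  choices in different blocks independent.\<close>

lemma block_sets_eq:
  fixes r :: "nat \<Rightarrow> nat" and n :: nat
  defines "s \<equiv> \<lambda>k. psum r k + k"
  shows "block_sets (s n) n r = (\<lambda>\<kappa>. {1..s n} - \<kappa> ` {..<n}) ` (\<Pi>\<^sub>E i\<in>{..<n}. {s i<..s (Suc i)})"
    and "inj_on (\<lambda>\<kappa>. {1..s n} - \<kappa> ` {..<n}) (\<Pi>\<^sub>E i\<in>{..<n}. {s i<..s (Suc i)})"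
proof -
  let ?B = "\<lambda>i. {s i<..s (Suc i)}"
  have s_Suc: "s (Suc i) = s i + Suc (r (Suc i))" for i
    by (simp add: s_def psum_def)
  have s: "s 0 = 0" "mono s"
    by (simp_all add: s_def psum_def mono_iff_le_Suc)
  have B_subset: "?B i \<subseteq> {1..s n}" if "i < n" for i
    using monoD[OF s(2), of "Suc i" n] that by auto
  have iff: "P \<in> block_sets (s n) n r \<longleftrightarrow> P \<subseteq> {1..s n} \<and> (\<forall>i<n. card (P \<inter> ?B i) = r (Suc i))" for P
  proof -
    have "{1..psum r k + k} - {1..psum r (k - 1) + k - 1} = ?B (k - 1)" if "k \<ge> 1" for k
      using that by (cases k) (auto simp: s_def)
    then have "P \<in> block_sets (s n) n r \<longleftrightarrow> P \<subseteq> {1..s n} \<and> (\<forall>k\<in>{1..n}. card (P \<inter> ?B (k - 1)) = r k)"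
      unfolding block_sets_def by simp
    also have "(\<forall>k\<in>{1..n}. card (P \<inter> ?B (k - 1)) = r k) \<longleftrightarrow> (\<forall>i<n. card (P \<inter> ?B i) = r (Suc i))"
      unfolding image_Suc_lessThan[symmetric] by auto
    finally show ?thesis .
  qed
  show "inj_on (\<lambda>\<kappa>. {1..s n} - \<kappa> ` {..<n}) (Pi\<^sub>E {..<n} ?B)"
  proof (rule inj_onI)
    fix \<kappa> \<mu> assume \<kappa>: "\<kappa> \<in> Pi\<^sub>E {..<n} ?B" and \<mu>: "\<mu> \<in> Pi\<^sub>E {..<n} ?B"
      and "{1..s n} - \<kappa> ` {..<n} = {1..s n} - \<mu> ` {..<n}"
    then have "\<kappa> ` {..<n} = \<mu> ` {..<n}"
      using block_choice_subset[OF s] by blast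
    then have "{\<kappa> i} = {\<mu> i}" if "i < n" for i
      using block_choice_Int[OF s \<kappa> that] block_choice_Int[OF s \<mu> that] by simp
    then show "\<kappa> = \<mu>"
      using \<kappa> \<mu> by (intro PiE_ext[of \<kappa> "{..<n}" ?B \<mu>]) auto
  qed
  show "block_sets (s n) n r = (\<lambda>\<kappa>. {1..s n} - \<kappa> ` {..<n}) ` Pi\<^sub>E {..<n} ?B"
  proof (intro Set.set_eqI iffI)
    fix P assume "P \<in> (\<lambda>\<kappa>. {1..s n} - \<kappa> ` {..<n}) ` Pi\<^sub>E {..<n} ?B"
    then obtain \<kappa> where \<kappa>: "\<kappa> \<in> Pi\<^sub>E {..<n} ?B" and P: "P = {1..s n} - \<kappa> ` {..<n}" by blast
    have "card (P \<inter> ?B i) = r (Suc i)" if i: "i < n" for i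
    proof -
      have "P \<inter> ?B i = ?B i - {\<kappa> i}"
        using block_choice_Int[OF s \<kappa> i] B_subset[OF i] unfolding P by blast
      moreover have "\<kappa> i \<in> ?B i" using PiE_mem[OF \<kappa>, of i] i by simp
      ultimately show ?thesis by (simp add: s_Suc)
    qed
    then show "P \<in> block_sets (s n) n r" unfolding iff by (auto simp: P)
  next
    fix P assume "P \<in> block_sets (s n) n r"
    then have P: "P \<subseteq> {1..s n}" and card: "\<And>i. i < n \<Longrightarrow> card (P \<inter> ?B i) = r (Suc i)"
      unfolding iff by auto
    have "\<exists>t. ?B i - P = {t}" if i: "i < n" for i
    proof -
      have "card (?B i - P) = card (?B i) - card (P \<inter> ?B i)"
        by (subst card_Diff_subset_Int) (auto simp: Int_commute)
      also have "\<dots> = 1" using card[OF i] by (simp add: s_Suc)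
      finally show ?thesis by (simp add: card_1_singleton_iff)
    qed
    then obtain \<mu> where \<mu>: "\<And>i. i < n \<Longrightarrow> ?B i - P = {\<mu> i}" by metis
    let ?\<kappa> = "restrict \<mu> {..<n}"
    have "?\<kappa> \<in> Pi\<^sub>E {..<n} ?B" using \<mu> by fastforce
    moreover have "P = {1..s n} - ?\<kappa> ` {..<n}"
    proof (intro Set.set_eqI iffI)
      fix t assume "t \<in> P"
      then show "t \<in> {1..s n} - ?\<kappa> ` {..<n}" using P \<mu> by fastforce
    next
      fix t assume t: "t \<in> {1..s n} - ?\<kappa> ` {..<n}"
      then obtain i where "i < n" "t \<in> ?B i" using ex_block[of s t n] s(1) by auto
      with \<mu>[of i] t show "t \<in> P" by auto
    qed
    ultimately show "P \<in> (\<lambda>\<kappa>. {1..s n} - \<kappa> ` {..<n}) ` Pi\<^sub>E {..<n} ?B" by blast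
  qed
qed

text \<open>The omitted labels are the tops of the blocks, here with blocks counted from 0; for
  \<open>block_max\<close> they are the bottoms.\<close>

lemma block_min_eq: "block_min K n r = {1..K} - (\<lambda>i. psum r (Suc i) + Suc i) ` {..<n}"
proof -
  have "{psum r k + k | k. k \<in> {1..n}} = (\<lambda>k. psum r k + k) ` Suc ` {..<n}"
    unfolding image_Suc_lessThan by auto
  then show ?thesis by (simp add: block_min_def image_image)
qed

lemma block_max_eq: "block_max K n r = {1..K} - (\<lambda>i. psum r i + Suc i) ` {..<n}"
proof -
  have "{psum r (k - 1) + k | k. k \<in> {1..n}} = (\<lambda>k. psum r (k - 1) + k) ` Suc ` {..<n}"
    unfolding image_Suc_lessThan by auto
  then show ?thesis by (simp add: block_max_def image_image)
qed

text \<open>Under complementation the defect becomes the total rise of the omitted labels above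
  \<open>b\<close>. It is non-negative, so the absolute value in the exponent of the sign does
  nothing.\<close>

lemma label_defect_compl:
  fixes \<kappa> b :: "nat \<Rightarrow> nat"
  assumes "inj_on \<kappa> {..<n}" "\<kappa> ` {..<n} \<subseteq> {1..K}" "inj_on b {..<n}" "b ` {..<n} \<subseteq> {1..K}"
    and "\<And>i. i < n \<Longrightarrow> b i \<le> \<kappa> i"
  shows "label_defect ({1..K} - b ` {..<n}) ({1..K} - \<kappa> ` {..<n}) = int (\<Sum>i<n. \<kappa> i - b i)"
proof -
  have sum_compl: "int (\<Sum>({1..K} - c ` {..<n})) = int (\<Sum>{1..K}) - (\<Sum>i<n. int (c i))"
    if "inj_on c {..<n}" "c ` {..<n} \<subseteq> {1..K}" for c :: "nat \<Rightarrow> nat"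
  proof -
    have "\<Sum>{1..K} = \<Sum>({1..K} - c ` {..<n}) + \<Sum>(c ` {..<n})"
      using that(2) by (rule sum.subset_diff) simp
    also have "\<Sum>(c ` {..<n}) = (\<Sum>i<n. c i)"
      using that(1) by (simp add: sum.reindex)
    finally show ?thesis by simp
  qed
  show ?thesis
    unfolding label_defect_def sum_compl[OF assms(1,2)] sum_compl[OF assms(3,4)]
    by (simp add: of_nat_diff sum_subtractf assms(5))
qed

section \<open>Evaluation of the determinant of block sums\<close>

lemma sum_blocks:
  fixes f :: "nat \<Rightarrow> 'a::comm_monoid_add"
  assumes "s 0 = 0" "mono s"
  shows "(\<Sum>k\<le>i. \<Sum>u\<in>{s k<..s (Suc k)}. f u) = (\<Sum>u\<in>{1..s (Suc i)}. f u)"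
proof (induction i)
  case 0
  have "{0<..s (Suc 0)} = {1..s (Suc 0)}" by auto
  then show ?case by (simp add: assms(1))
next
  case (Suc i)
  have "s (Suc i) \<le> s (Suc (Suc i))" using assms(2) by (simp add: monoD)
  then have "{1..s (Suc (Suc i))} = {1..s (Suc i)} \<union> {s (Suc i)<..s (Suc (Suc i))}" by auto
  then have "(\<Sum>u\<in>{1..s (Suc (Suc i))}. f u) = (\<Sum>u\<in>{1..s (Suc i)}. f u) + (\<Sum>u\<in>{s (Suc i)<..s (Suc (Suc i))}. f u)"
    by (simp only:) (rule sum.union_disjoint, auto)
  then show ?case using Suc.IH by simp
qed

text \<open>Adding all earlier rows to each row joins the blocks to initial segments.\<close>

lemma fdet_blocks:
  fixes s :: "nat \<Rightarrow> nat" and f :: "nat \<Rightarrow> nat \<Rightarrow> 'a::comm_ring_1"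
  assumes "s 0 = 0" "mono s"
  shows "fdet n (\<lambda>i j. \<Sum>u\<in>{s i<..s (Suc i)}. f u j) = fdet n (\<lambda>i j. \<Sum>u\<in>{1..s (Suc i)}. f u j)"
proof -
  let ?E = "\<lambda>i j. \<Sum>u\<in>{s i<..s (Suc i)}. f u j" and ?T = "\<lambda>i k. if k \<le> i then 1 else (0::'a)"
  have "fdet n ?E = fdet n (\<lambda>i j. \<Sum>k<n. ?T i k * ?E k j)"
    by (rule fdet_unitriangular_rows[symmetric]) auto
  also have "\<dots> = fdet n (\<lambda>i j. \<Sum>u\<in>{1..s (Suc i)}. f u j)"
  proof (rule fdet_cong)
    fix i j assume "i < n" "j < n"
    then have "(\<Sum>k<n. ?T i k * ?E k j) = (\<Sum>k\<le>i. ?E k j)"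
      by (intro sum.mono_neutral_cong_right) auto
    also have "\<dots> = (\<Sum>u\<in>{1..s (Suc i)}. f u j)"
      using assms by (rule sum_blocks)
    finally show "(\<Sum>k<n. ?T i k * ?E k j) = (\<Sum>u\<in>{1..s (Suc i)}. f u j)" .
  qed
  finally show ?thesis .
qed

text \<open>The sum telescopes, and its lower end \<open>path_sum m x (- b)\<close> vanishes because
  \<open>b\<close> is positive.\<close>

lemma sum_path_sum_diff:
  assumes "0 < b"
  shows "(\<Sum>u\<in>{1..v}. path_sum m x (int u - int b) - path_sum m x (int u - int (Suc b))) =
    path_sum m x (int v - int b)"
  by (induction v) (use assms in \<open>simp_all add: path_sum_eq_0 algebra_simps\<close>)

text \<open>The range contains the whole support \<open>{b..b + m}\<close> of the summand.\<close>

lemma sum_path_sum_shift: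
  assumes "0 < b"
  shows "(\<Sum>u\<in>{1..b + m}. path_sum m x (int u - int b)) = (\<Prod>i=1..m. 1 + x i)"
proof -
  have "(\<Sum>u\<in>{1..b + m}. path_sum m x (int u - int b)) = (\<Sum>u\<in>{b..b + m}. path_sum m x (int u - int b))"
    using assms by (intro sum.mono_neutral_right) (auto intro!: path_sum_eq_0)
  also have "\<dots> = (\<Sum>k\<le>m. path_sum m x (int k))"
    by (rule sum.reindex_bij_witness[of _ "\<lambda>k. k + b" "\<lambda>u. u - b"]) (auto simp: of_nat_diff)
  finally show ?thesis by (simp add: sum_path_sum)
qed

text \<open>From column \<open>l\<close> on the labels \<open>b j\<close> are consecutive, so
  neighbouring columns of partial sums differ by a column of values of \<open>h\<close>. After this
  reduction both determinants expand along the last row with the same minor.\<close>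

lemma fdet_block_columns:
  fixes b v :: "nat \<Rightarrow> nat" and x :: "nat \<Rightarrow> 'a::comm_ring_1"
  assumes "0 < n" "l \<le> n" and b: "\<And>j. b j = min j l + Suc j" and v: "v (n - 1) = m + n + l"
  defines "h \<equiv> path_sum m x"
  shows "fdet n (\<lambda>i j. if j < l then h (int (v i) - int (b j)) else \<Sum>u\<in>{1..v i}. h (int u - int (b j)))
    = (\<Prod>i=1..m. 1 + x i) * fdet n (\<lambda>i j. h (int (v i) - int (b j)))"
    (is "fdet n ?X = ?c * fdet n ?Y")
proof -
  obtain p where n: "n = Suc p" using \<open>0 < n\<close> gr0_implies_Suc by blast
  have v: "v p = m + n + l" using v n by simp
  \<comment> \<open>Here \<open>v p - b j\<close> is at least \<open>m + 1\<close>, beyond the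
    support of \<open>h\<close>.\<close>
  have last_row: "?Y p j = 0" if "j < p \<or> l = n" "j < n" for j
    unfolding h_def by (rule path_sum_eq_0) (use that n b v in auto)
  show ?thesis
  proof (cases "l = n")
    case True
    then have "fdet n ?Y = 0" "fdet n ?X = 0"
      using last_row n by (auto intro!: fdet_zero_row[of p])
    then show ?thesis by simp
  next
    case False
    with \<open>l \<le> n\<close> n have "l \<le> p" by simp
    \<comment> \<open>\<open>Z\<close> is the reduced array, with partial sums only in the last
      column. The matrix \<open>?T\<close> recovers \<open>?X\<close> from it: for
      \<open>l \<le> j\<close>, column \<open>j\<close> of \<open>?X\<close> is the sum of the
      columns \<open>j\<close> to \<open>p\<close> of \<open>Z\<close>.\<close>
    define Z where "Z = (\<lambda>i j. if j < p then ?Y i j else \<Sum>u\<in>{1..v i}. h (int u - int (b j)))"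
    let ?T = "\<lambda>k j. if k = j \<or> l \<le> j \<and> j < k then 1 else (0::'a)"
    have b_Suc: "b (Suc j) = Suc (b j)" if "l \<le> j" for j using that by (simp add: b)
    have peel: "(\<Sum>u\<in>{1..w}. h (int u - int (b j))) = h (int w - int (b j)) + (\<Sum>u\<in>{1..w}. h (int u - int (b (Suc j))))"
      if "l \<le> j" for j w
      using sum_path_sum_diff[of "b j" m x w] b_Suc[OF that]
      by (simp add: h_def b sum_subtractf algebra_simps)
    have tail: "(\<Sum>u\<in>{1..v i}. h (int u - int (b j))) = (\<Sum>k\<in>{j..p}. Z i k)" if "l \<le> j" "j \<le> p" for i j
      using that(2,1)
    proof (induction j rule: inc_induct)
      case base
      show ?case by (simp add: Z_def)
    next
      case (step j)
      have "(\<Sum>u\<in>{1..v i}. h (int u - int (b j))) = h (int (v i) - int (b j)) + (\<Sum>u\<in>{1..v i}. h (int u - int (b (Suc j))))"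
        by (rule peel[OF step.prems])
      also have "\<dots> = Z i j + (\<Sum>k\<in>{Suc j..p}. Z i k)"
        using step.hyps step.prems step.IH by (simp add: Z_def)
      also have "\<dots> = (\<Sum>k\<in>{j..p}. Z i k)"
        using step.hyps by (simp add: sum.atLeast_Suc_atMost)
      finally show ?case .
    qed
    have "fdet n ?X = fdet n (\<lambda>i j. \<Sum>k<n. Z i k * ?T k j)"
    proof (rule fdet_cong)
      fix i j assume "i < n" "j < n"
      show "?X i j = (\<Sum>k<n. Z i k * ?T k j)"
      proof (cases "j < l")
        case True
        then have "(\<Sum>k<n. Z i k * ?T k j) = (\<Sum>k\<in>{j}. Z i k)"
          using \<open>j < n\<close> by (intro sum.mono_neutral_cong_right) auto
        with True \<open>l \<le> p\<close> show ?thesis by (simp add: Z_def)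
      next
        case False
        then have "(\<Sum>k<n. Z i k * ?T k j) = (\<Sum>k\<in>{j..p}. Z i k)"
          using n by (intro sum.mono_neutral_cong_right) auto
        with False show ?thesis using tail[of j i] \<open>j < n\<close> n by simp
      qed
    qed
    also have "\<dots> = fdet n Z"
      by (rule fdet_unitriangular_cols) auto
    also have "\<dots> = Z p p * fdet p Z"
      unfolding n by (rule fdet_Suc_last_row) (use last_row n in \<open>simp add: Z_def\<close>)
    \<comment> \<open>Since \<open>l \<le> p\<close>, the label \<open>b p\<close> equals
      \<open>n + l\<close>, so that \<open>v p = b p + m\<close> and the sum runs over the full
      support.\<close>
    also have "Z p p = ?c"
      using sum_path_sum_shift[of "b p" m x] v \<open>l \<le> p\<close> n by (simp add: Z_def h_def b algebra_simps)
    also have "fdet p Z = fdet n ?Y"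
    proof -
      have "fdet n ?Y = ?Y p p * fdet p ?Y"
        unfolding n by (rule fdet_Suc_last_row) (use last_row n in simp)
      moreover have "int (v p) - int (b p) = int m" using v \<open>l \<le> p\<close> n by (simp add: b)
      moreover have "fdet p Z = fdet p ?Y"
        by (rule fdet_cong) (simp add: Z_def)
      ultimately show ?thesis by (simp add: h_def path_sum_top)
    qed
    finally show ?thesis .
  qed
qed

section \<open>The signed sum over block sets as a single determinant\<close>

theorem theorem2p10:
  fixes m n l :: nat and r r' :: "nat \<Rightarrow> nat" and x :: "nat \<Rightarrow> 'a::comm_ring_1"
  assumes "m > 0" and "n > 0" and "l > 0" and "l \<le> n"
    and "(\<Sum>i=1..n. r i) = m + l"
    and "\<And>i. i \<in> {1..l} \<Longrightarrow> r' i = 1"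
    and "\<And>j. j \<in> {l+1..n} \<Longrightarrow> r' j = 0"
  shows "(\<Sum>(P, P') \<in> block_sets (m + n + l) n r \<times> block_sets (n + l) n r'.
            (- 1) ^ nat \<bar>label_defect (block_max (n + l) n r') P'\<bar>
              * tiling_sum m x (dented_trapezoid (n + l) m P P'))
         = (\<Prod>i=1..m. 1 + x i)
             * tiling_sum m x (dented_trapezoid (n + l) m
                 (block_min (m + n + l) n r) (block_max (n + l) n r'))"
proof -
  define h where "h = path_sum m x"
  define s s' where "s = (\<lambda>k. psum r k + k)" and "s' = (\<lambda>k. psum r' k + k)"
  \<comment> \<open>\<open>b j\<close> is the bottom label of block \<open>j\<close> on the left
    side, the one omitted by \<open>block_max\<close>.\<close>
  define b where "b = (\<lambda>j. min j l + Suc j)"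
  let ?B = "\<lambda>i. {s i<..s (Suc i)}" and ?B' = "\<lambda>j. {s' j<..s' (Suc j)}"
  obtain m' where m': "m = Suc m'" using \<open>m > 0\<close> gr0_implies_Suc by blast
  have s: "s 0 = 0" "strict_mono s" and s'0: "s' 0 = 0" "strict_mono s'"
    by (simp_all add: s_def s'_def psum_def strict_mono_Suc_iff)
  have psum': "psum r' k = min k l" if "k \<le> n" for k
    using that by (induction k) (auto simp: psum_def assms(6,7) min_def)
  have s'_eq: "s' k = min k l + k" if "k \<le> n" for k
    by (simp add: s'_def psum'[OF that])
  have sn: "s n = m + n + l" "s' n = n + l"
    using assms(4,5) s'_eq[of n] by (simp_all add: s_def psum_def)
  have K: "m + n + l = (n + l) + Suc m'" by (simp add: m')

  have max_eq: "block_max (n + l) n r' = {1..n + l} - b ` {..<n}"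
    unfolding block_max_eq by (intro arg_cong2[of _ _ _ _ "(-)"] image_cong) (simp_all add: psum' b_def)
  have min_eq: "block_min (m + n + l) n r = {1..m + n + l} - (\<lambda>i. s (Suc i)) ` {..<n}"
    unfolding block_min_eq s_def ..
  have b: "strict_mono_on {..<n} b" "b ` {..<n} \<subseteq> {1..n + l}" "inj_on b {..<n}"
  proof -
    have "strict_mono b" by (auto simp: b_def strict_mono_Suc_iff min_def)
    then show "strict_mono_on {..<n} b" "inj_on b {..<n}"
      by (auto simp: strict_mono_on_def strict_mono_def inj_on_def intro: strict_mono_eq[THEN iffD1])
    show "b ` {..<n} \<subseteq> {1..n + l}" by (auto simp: b_def)
  qed
  have v: "strict_mono_on {..<n} (\<lambda>i. s (Suc i))" "(\<lambda>i. s (Suc i)) ` {..<n} \<subseteq> {1..m + n + l}"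
  proof -
    show "strict_mono_on {..<n} (\<lambda>i. s (Suc i))"
      using s(2) by (auto simp: strict_mono_def intro!: strict_mono_onI)
    have "0 < s (Suc i)" for i using strict_monoD[OF s(2), of 0 "Suc i"] by simp
    moreover have "s (Suc i) \<le> s n" if "i < n" for i
      using that strict_mono_mono[OF s(2)] by (simp add: monoD)
    ultimately show "(\<lambda>i. s (Suc i)) ` {..<n} \<subseteq> {1..m + n + l}"
      by (auto simp: sn Suc_le_eq)
  qed
  have M: "tiling_sum m x (dented_trapezoid (n + l) m ({1..m + n + l} - c ` {..<n}) ({1..n + l} - d ` {..<n}))
      = fdet n (\<lambda>i j. h (int (c i) - int (d j)))"
    if "strict_mono_on {..<n} c" "c ` {..<n} \<subseteq> {1..m + n + l}"
      "strict_mono_on {..<n} d" "d ` {..<n} \<subseteq> {1..n + l}" for c d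
    using tiling_sum_dented[OF that(1) that(2)[unfolded K] that(3,4), of x] unfolding h_def K unfolding m' .

  \<comment> \<open>The sign is a product over the particles, so each factor can be moved into its
    own column.\<close>
  have summand: "(- 1) ^ nat \<bar>label_defect (block_max (n + l) n r') ({1..n + l} - \<mu> ` {..<n})\<bar>
      * tiling_sum m x (dented_trapezoid (n + l) m ({1..m + n + l} - \<kappa> ` {..<n}) ({1..n + l} - \<mu> ` {..<n}))
      = fdet n (\<lambda>i j. (- 1) ^ (\<mu> j - b j) * h (int (\<kappa> i) - int (\<mu> j)))"
    if \<kappa>: "\<kappa> \<in> Pi\<^sub>E {..<n} ?B" and \<mu>: "\<mu> \<in> Pi\<^sub>E {..<n} ?B'" for \<kappa> \<mu>
  proof -
    note \<kappa>' = strict_mono_on_block_choice[OF s(1) strict_mono_mono[OF s(2)] \<kappa>]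
      block_choice_subset[OF s(1) strict_mono_mono[OF s(2)] \<kappa>, unfolded sn]
    note \<mu>' = strict_mono_on_block_choice[OF s'0(1) strict_mono_mono[OF s'0(2)] \<mu>]
      block_choice_subset[OF s'0(1) strict_mono_mono[OF s'0(2)] \<mu>, unfolded sn]
    have "b j \<le> \<mu> j" if "j < n" for j
      using PiE_mem[OF \<mu>, of j] that s'_eq[of j] by (simp add: b_def)
    then have "label_defect (block_max (n + l) n r') ({1..n + l} - \<mu> ` {..<n}) = int (\<Sum>j<n. \<mu> j - b j)"
      unfolding max_eq using b \<mu>' by (intro label_defect_compl) (auto intro: strict_mono_on_imp_inj_on)
    then show ?thesis
      unfolding M[OF \<kappa>' \<mu>'] by (simp only: abs_of_nat nat_int fdet_scale_cols power_sum)
  qed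

  have blocks: "block_sets (m + n + l) n r = (\<lambda>\<kappa>. {1..m + n + l} - \<kappa> ` {..<n}) ` Pi\<^sub>E {..<n} ?B"
      "inj_on (\<lambda>\<kappa>. {1..m + n + l} - \<kappa> ` {..<n}) (Pi\<^sub>E {..<n} ?B)"
    using block_sets_eq[of r n] sn(1) unfolding s_def by (simp_all only:)
  have blocks': "block_sets (n + l) n r' = (\<lambda>\<kappa>. {1..n + l} - \<kappa> ` {..<n}) ` Pi\<^sub>E {..<n} ?B'"
      "inj_on (\<lambda>\<kappa>. {1..n + l} - \<kappa> ` {..<n}) (Pi\<^sub>E {..<n} ?B')"
    using block_sets_eq[of r' n] sn(2) unfolding s'_def by (simp_all only:)
  have "(\<Sum>(P, P') \<in> block_sets (m + n + l) n r \<times> block_sets (n + l) n r'.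
            (- 1) ^ nat \<bar>label_defect (block_max (n + l) n r') P'\<bar>
              * tiling_sum m x (dented_trapezoid (n + l) m P P'))
      = (\<Sum>\<kappa>\<in>Pi\<^sub>E {..<n} ?B. \<Sum>\<mu>\<in>Pi\<^sub>E {..<n} ?B'.
           fdet n (\<lambda>i j. (- 1) ^ (\<mu> j - b j) * h (int (\<kappa> i) - int (\<mu> j))))"
    unfolding sum.cartesian_product[symmetric] blocks(1) blocks'(1)
      sum.reindex[OF blocks(2)] sum.reindex[OF blocks'(2)] comp_def
    by (intro sum.cong refl summand)
  \<comment> \<open>Row \<open>i\<close> depends only on \<open>\<kappa> i\<close> and column
    \<open>j\<close>, including its sign, only on \<open>\<mu> j\<close>, so both sums move into the
    entries.\<close>
  also have "\<dots> = fdet n (\<lambda>i j. \<Sum>u\<in>?B i. \<Sum>t\<in>?B' j. (- 1) ^ (t - b j) * h (int u - int t))"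
    by (simp add: fdet_sum_cols fdet_sum_rows)
  also have "\<dots> = fdet n (\<lambda>i j. \<Sum>u\<in>{1..s (Suc i)}. \<Sum>t\<in>?B' j. (- 1) ^ (t - b j) * h (int u - int t))"
    by (rule fdet_blocks[OF s(1) strict_mono_mono[OF s(2)]])
  also have "\<dots> = fdet n (\<lambda>i j. if j < l then h (int (s (Suc i)) - int (b j))
                   else \<Sum>u\<in>{1..s (Suc i)}. h (int u - int (b j)))"
  proof (rule fdet_cong)
    fix i j assume "i < n" and j: "j < n"
    show "(\<Sum>u\<in>{1..s (Suc i)}. \<Sum>t\<in>?B' j. (- 1) ^ (t - b j) * h (int u - int t)) =
      (if j < l then h (int (s (Suc i)) - int (b j)) else \<Sum>u\<in>{1..s (Suc i)}. h (int u - int (b j)))"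
    proof (cases "j < l")
      case True
      \<comment> \<open>A block with \<open>r' = 1\<close> has two labels with opposite signs, and
        the resulting difference telescopes over \<open>u\<close>.\<close>
      then have "?B' j = {b j, Suc (b j)}"
        using s'_eq[of j] s'_eq[of "Suc j"] j by (auto simp: b_def)
      then have "(\<Sum>t\<in>?B' j. (- 1) ^ (t - b j) * h (int u - int t)) = h (int u - int (b j)) - h (int u - int (Suc (b j)))" for u
        by simp
      then show ?thesis
        using sum_path_sum_diff[of "b j" m x "s (Suc i)"] True unfolding h_def by (simp add: b_def)
    next
      case False
      \<comment> \<open>A block with \<open>r' = 0\<close> has one label, so nothing cancels and the
        partial sum remains.\<close>
      then have "?B' j = {b j}"
        using s'_eq[of j] s'_eq[of "Suc j"] j by (auto simp: b_def)
      with False show ?thesis by simp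
    qed
  qed
  also have "\<dots> = (\<Prod>i=1..m. 1 + x i) * fdet n (\<lambda>i j. h (int (s (Suc i)) - int (b j)))"
    unfolding h_def using assms(2,4) sn(1) by (intro fdet_block_columns) (simp_all add: b_def)
  also have "fdet n (\<lambda>i j. h (int (s (Suc i)) - int (b j))) =
      tiling_sum m x (dented_trapezoid (n + l) m (block_min (m + n + l) n r) (block_max (n + l) n r'))"
    unfolding max_eq min_eq by (rule M[symmetric, OF v b(1,2)])
  finally show ?thesis .
qed

end
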